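(* Let $X$ be a proper hyperbolic geodesic metric space and let $G<\mathrm{Iso}(X)$ be a non-elementary closed subgroup with limit set $\Lambda\subset\partial X$. If $G$ acts transitively on the complement of the diagonal in $\Lambda\times\Lambda$, then the kernel of the natural map $H^2_{cb}(G,\mathbb{R})\to H^2_c(G,\mathbb{R})$ is trivial.
   Context: A geodesic metric space $X$ is hyperbolic if for some $\delta>0$ every side of every geodesic triangle in $X$ is contained in the $\delta$-neighborhood of the union of the other two sides. If $X$ is proper, $\partial X$ denotes its Gromov boundary, and the isometry group $\mathrm{Iso}(X)$ carries the compact open topology. The limit set of a closed subgroup $G$ of $\mathrm{Iso}(X)$ is the set of accumulation points in $\partial X$ of a $G$-orbit in $X$; $G$ is elementary if its limit set consists of at most two points. For a locally compact group $G$, $H^*_{cb}(G,\mathbb{R})$ (continuous bounded cohomology with trivial real coefficients) is the cohomology of the complex $0\to C_b(G,\mathbb{R})^G\to C_b(G^2,\mathbb{R})^G\to C_b(G^3,\mathbb{R})^G\to\cdots$ of bounded continuous $G$-invariant functions with the homogeneous coboundary operator (degree $n$ corresponds to $G^{n+1}$). $H^*_c(G,\mathbb{R})$ is ordinary continuous cohomology, defined by the same complex without the boundedness requirement, and the natural map is induced by the inclusion of complexes. *)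

theory Defs
  imports "HOL-Analysis.Analysis" "HOL-Algebra.Coset"
begin

definition proper_space :: "'a::metric_space itself \<Rightarrow> bool" where
  "proper_space _ \<longleftrightarrow> (\<forall>(x::'a) r. compact (cball x r))"

definition geodesic_segment :: "'a::metric_space \<Rightarrow> 'a \<Rightarrow> 'a set \<Rightarrow> bool" where
  "geodesic_segment x y S \<longleftrightarrow>
     (\<exists>c :: real \<Rightarrow> 'a. c 0 = x \<and> c (dist x y) = y \<and> S = c ` {0..dist x y} \<and>
        (\<forall>s\<in>{0..dist x y}. \<forall>t\<in>{0..dist x y}. dist (c s) (c t) = \<bar>s - t\<bar>))"

definition geodesic_space :: "'a::metric_space itself \<Rightarrow> bool" where
  "geodesic_space _ \<longleftrightarrow> (\<forall>x y :: 'a. \<exists>S. geodesic_segment x y S)"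

definition set_nbhd :: "real \<Rightarrow> 'a::metric_space set \<Rightarrow> 'a set" where
  "set_nbhd r S = (\<Union>q\<in>S. ball q r)"

definition hyperbolic_space :: "'a::metric_space itself \<Rightarrow> bool" where
  "hyperbolic_space _ \<longleftrightarrow>
     (\<exists>\<delta>>0. \<forall>(x::'a) y z A B C.
        geodesic_segment x y A \<and> geodesic_segment y z B \<and> geodesic_segment z x C \<longrightarrow>
        A \<subseteq> set_nbhd \<delta> (B \<union> C) \<and> B \<subseteq> set_nbhd \<delta> (C \<union> A) \<and> C \<subseteq> set_nbhd \<delta> (A \<union> B))"

definition gromov_product :: "'a::metric_space \<Rightarrow> 'a \<Rightarrow> 'a \<Rightarrow> real" where
  "gromov_product p x y = (dist p x + dist p y - dist x y) / 2"

text \<open>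
  Gromov products at two base points differ by at most the distance of the base points, so
  quantifying over the base point, here and below, merely avoids choosing one.
\<close>

definition gromov_asymptotic :: "(nat \<Rightarrow> 'a::metric_space) \<Rightarrow> (nat \<Rightarrow> 'a) \<Rightarrow> bool" where
  "gromov_asymptotic u v \<longleftrightarrow>
     (\<forall>p. filterlim (\<lambda>(i, j). gromov_product p (u i) (v j)) at_top (sequentially \<times>\<^sub>F sequentially))"

definition gromov_sequences :: "(nat \<Rightarrow> 'a::metric_space) set" where
  "gromov_sequences = {u. gromov_asymptotic u u}"

definition gromov_boundary :: "(nat \<Rightarrow> 'a::metric_space) set set" where
  "gromov_boundary =
     gromov_sequences //
       {(u, v). u \<in> gromov_sequences \<and> v \<in> gromov_sequences \<and> gromov_asymptotic u v}"

text \<open>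
  The disjoint union of the space and its boundary is modelled by a sum type. A point is
  represented by the sequences converging to it, and the Gromov product is extended by
  \<open>(a|b) = sup liminf (u\<^sub>i|v\<^sub>j)\<close>, the supremum being over all representing sequences.
\<close>

type_synonym 'a compactification_point = "'a + (nat \<Rightarrow> 'a) set"

fun representing_sequences ::
    "'a::metric_space compactification_point \<Rightarrow> (nat \<Rightarrow> 'a) set" where
  "representing_sequences (Inl x) = {u. u \<longlonglongrightarrow> x}"
| "representing_sequences (Inr \<xi>) = \<xi>"

definition extended_gromov_product ::
    "'a::metric_space \<Rightarrow> 'a compactification_point \<Rightarrow> 'a compactification_point \<Rightarrow> ereal" where
  "extended_gromov_product p a b =
     (SUP (u, v) \<in> representing_sequences a \<times> representing_sequences b.
        Liminf (sequentially \<times>\<^sub>F sequentially) (\<lambda>(i, j). ereal (gromov_product p (u i) (v j))))"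

definition compactification_points :: "'a::metric_space compactification_point set" where
  "compactification_points = range Inl \<union> Inr ` gromov_boundary"

definition gromov_nbhd ::
    "'a::metric_space \<Rightarrow> (nat \<Rightarrow> 'a) set \<Rightarrow> real \<Rightarrow> 'a compactification_point set" where
  "gromov_nbhd p \<xi> r =
     {z \<in> compactification_points. extended_gromov_product p (Inr \<xi>) z > ereal r}"

definition compactification_open :: "'a::metric_space compactification_point set \<Rightarrow> bool" where
  "compactification_open U \<longleftrightarrow>
     U \<subseteq> compactification_points \<and> open {x. Inl x \<in> U} \<and>
     (\<forall>p \<xi>. Inr \<xi> \<in> U \<longrightarrow> (\<exists>r. gromov_nbhd p \<xi> r \<subseteq> U))"

definition gromov_compactification :: "'a::metric_space compactification_point topology" where
  "gromov_compactification = topology compactification_open"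

lemma istopology_compactification_open: "istopology compactification_open"
  unfolding istopology_def
proof (intro conjI allI impI)
  fix S T :: "'a compactification_point set"
  assume S: "compactification_open S" and T: "compactification_open T"
  have "\<exists>r. gromov_nbhd p \<xi> r \<subseteq> S \<inter> T" if "Inr \<xi> \<in> S \<inter> T" for p \<xi>
  proof -
    have "\<exists>r. gromov_nbhd p \<xi> r \<subseteq> S" "\<exists>s. gromov_nbhd p \<xi> s \<subseteq> T"
      using S T that by (simp_all add: compactification_open_def)
    then obtain r s where rs: "gromov_nbhd p \<xi> r \<subseteq> S" "gromov_nbhd p \<xi> s \<subseteq> T"
      by blast
    have "gromov_nbhd p \<xi> (max r s) \<subseteq> gromov_nbhd p \<xi> t" if "t \<le> max r s" for t
    proof -
      have "ereal t \<le> ereal (max r s)"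
        using that by (simp only: ereal_less_eq)
      then show ?thesis
        by (auto simp only: gromov_nbhd_def intro: order.strict_trans1)
    qed
    then have "gromov_nbhd p \<xi> (max r s) \<subseteq> gromov_nbhd p \<xi> r \<inter> gromov_nbhd p \<xi> s"
      by simp
    then show ?thesis
      using rs by blast
  qed
  moreover have "open {x. Inl x \<in> S \<inter> T}"
    using S T open_Int[of "{x. Inl x \<in> S}" "{x. Inl x \<in> T}"]
    by (simp add: compactification_open_def Int_def)
  ultimately show "compactification_open (S \<inter> T)"
    using S T unfolding compactification_open_def by blast
next
  fix \<K> :: "'a compactification_point set set"
  assume K: "\<forall>K\<in>\<K>. compactification_open K"
  have "open (\<Union>K\<in>\<K>. {x. Inl x \<in> K})"
    using K by (auto simp: compactification_open_def)
  moreover have "{x. Inl x \<in> \<Union>\<K>} = (\<Union>K\<in>\<K>. {x. Inl x \<in> K})"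
    by auto
  moreover have "\<exists>r. gromov_nbhd p \<xi> r \<subseteq> \<Union>\<K>" if "Inr \<xi> \<in> \<Union>\<K>" for p \<xi>
    using K that unfolding compactification_open_def by (meson Union_iff Sup_upper order_trans)
  ultimately show "compactification_open (\<Union>\<K>)"
    using K unfolding compactification_open_def by auto
qed

lemma openin_gromov_compactification:
  "openin gromov_compactification U \<longleftrightarrow> compactification_open U"
  by (simp add: gromov_compactification_def istopology_compactification_open)

lemma topspace_gromov_compactification:
  "topspace gromov_compactification = compactification_points"
proof -
  have "compactification_open (compactification_points :: 'a compactification_point set)"
    by (auto simp: compactification_open_def gromov_nbhd_def compactification_points_def)
  then show ?thesis
    unfolding topspace_def openin_gromov_compactification
    by (auto simp: compactification_open_def)
qed

definition isometry_group :: "('a::metric_space \<Rightarrow> 'a) monoid" where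
  "isometry_group =
     \<lparr>carrier = {f. surj f \<and> (\<forall>x y. dist (f x) (f y) = dist x y)}, mult = (\<circ>), one = id\<rparr>"

definition isometry_topology :: "('a::metric_space \<Rightarrow> 'a) topology" where
  "isometry_topology =
     topology_generated_by
       {{f \<in> carrier isometry_group. f ` K \<subseteq> U} | K U. compact K \<and> open U}"

text \<open>
  The limit set does not depend on the point \<open>x\<close> whose orbit is taken.
\<close>

definition limit_set :: "('a::metric_space \<Rightarrow> 'a) set \<Rightarrow> 'a \<Rightarrow> (nat \<Rightarrow> 'a) set set" where
  "limit_set G x =
     {\<xi> \<in> gromov_boundary. Inr \<xi> \<in> gromov_compactification derived_set_of (\<lambda>g. Inl (g x)) ` G}"

definition elementary :: "('a::metric_space \<Rightarrow> 'a) set \<Rightarrow> 'a \<Rightarrow> bool" where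
  "elementary G x \<longleftrightarrow> finite (limit_set G x) \<and> card (limit_set G x) \<le> 2"

text \<open>
  A surjective isometry permutes the Gromov sequences and preserves \<open>gromov_asymptotic\<close>, so
  the image of a boundary point under postcomposition is again a full equivalence class.
\<close>

definition boundary_action :: "('a \<Rightarrow> 'a) \<Rightarrow> (nat \<Rightarrow> 'a) set \<Rightarrow> (nat \<Rightarrow> 'a) set" where
  "boundary_action g \<xi> = (\<lambda>u. g \<circ> u) ` \<xi>"

text \<open>
  An element of \<open>G\<^sup>n\<^sup>+\<^sup>1\<close> is an extensional function on \<open>{..n}\<close>, and a cochain of
  degree \<open>n\<close> is extended by 0 outside \<open>G\<^sup>n\<^sup>+\<^sup>1\<close>, so that cochains are equal iff
  they agree on \<open>G\<^sup>n\<^sup>+\<^sup>1\<close>.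
\<close>

definition tuples :: "('g, 'b) monoid_scheme \<Rightarrow> nat \<Rightarrow> (nat \<Rightarrow> 'g) set" where
  "tuples G n = (\<Pi>\<^sub>E i\<in>{..n}. carrier G)"

definition continuous_cochains ::
    "('g, 'b) monoid_scheme \<Rightarrow> 'g topology \<Rightarrow> nat \<Rightarrow> ((nat \<Rightarrow> 'g) \<Rightarrow> real) set" where
  "continuous_cochains G T n =
     {f. continuous_map (product_topology (\<lambda>_. subtopology T (carrier G)) {..n}) euclideanreal f \<and>
         (\<forall>g\<in>carrier G. \<forall>x\<in>tuples G n. f (\<lambda>i\<in>{..n}. g \<otimes>\<^bsub>G\<^esub> x i) = f x) \<and>
         (\<forall>x. x \<notin> tuples G n \<longrightarrow> f x = 0)}"

definition bounded_cochains ::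
    "('g, 'b) monoid_scheme \<Rightarrow> 'g topology \<Rightarrow> nat \<Rightarrow> ((nat \<Rightarrow> 'g) \<Rightarrow> real) set" where
  "bounded_cochains G T n = {f \<in> continuous_cochains G T n. bounded (f ` tuples G n)}"

definition omit :: "nat \<Rightarrow> nat \<Rightarrow> (nat \<Rightarrow> 'g) \<Rightarrow> nat \<Rightarrow> 'g" where
  "omit n i x = (\<lambda>j\<in>{..n}. if j < i then x j else x (Suc j))"

definition coboundary_op ::
    "('g, 'b) monoid_scheme \<Rightarrow> nat \<Rightarrow> ((nat \<Rightarrow> 'g) \<Rightarrow> real) \<Rightarrow> (nat \<Rightarrow> 'g) \<Rightarrow> real" where
  "coboundary_op G n f x =
     (if x \<in> tuples G (Suc n) then \<Sum>i\<le>Suc n. (- 1) ^ i * f (omit n i x) else 0)"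

definition cocycles ::
    "('g, 'b) monoid_scheme \<Rightarrow> (nat \<Rightarrow> ((nat \<Rightarrow> 'g) \<Rightarrow> real) set) \<Rightarrow> nat \<Rightarrow>
     ((nat \<Rightarrow> 'g) \<Rightarrow> real) set" where
  "cocycles G C n = {f \<in> C n. coboundary_op G n f = (\<lambda>_. 0)}"

fun coboundaries ::
    "('g, 'b) monoid_scheme \<Rightarrow> (nat \<Rightarrow> ((nat \<Rightarrow> 'g) \<Rightarrow> real) set) \<Rightarrow> nat \<Rightarrow>
     ((nat \<Rightarrow> 'g) \<Rightarrow> real) set" where
  "coboundaries G C 0 = {\<lambda>_. 0}"
| "coboundaries G C (Suc n) = coboundary_op G n ` C n"

definition cocycle_group ::
    "('g, 'b) monoid_scheme \<Rightarrow> (nat \<Rightarrow> ((nat \<Rightarrow> 'g) \<Rightarrow> real) set) \<Rightarrow> nat \<Rightarrow>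
     ((nat \<Rightarrow> 'g) \<Rightarrow> real) monoid" where
  "cocycle_group G C n =
     \<lparr>carrier = cocycles G C n, mult = (\<lambda>f h x. f x + h x), one = (\<lambda>_. 0)\<rparr>"

definition cohomology ::
    "('g, 'b) monoid_scheme \<Rightarrow> (nat \<Rightarrow> ((nat \<Rightarrow> 'g) \<Rightarrow> real) set) \<Rightarrow> nat \<Rightarrow>
     ((nat \<Rightarrow> 'g) \<Rightarrow> real) set monoid" where
  "cohomology G C n = cocycle_group G C n Mod coboundaries G C n"

abbreviation H_c where "H_c G T \<equiv> cohomology G (continuous_cochains G T)"

abbreviation H_cb where "H_cb G T \<equiv> cohomology G (bounded_cochains G T)"

text \<open>
  The map induced by the inclusion of cochains sends the class of a bounded cocycle \<open>f\<close>
  in \<open>H_cb\<close> to the class of \<open>f\<close> in \<open>H_c\<close>.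
\<close>

definition comparison_map ::
    "('g, 'b) monoid_scheme \<Rightarrow> 'g topology \<Rightarrow> nat \<Rightarrow>
     ((nat \<Rightarrow> 'g) \<Rightarrow> real) set \<Rightarrow> ((nat \<Rightarrow> 'g) \<Rightarrow> real) set" where
  "comparison_map G T n U =
     (\<Union>f\<in>U. coboundaries G (continuous_cochains G T) n
                #>\<^bsub>cocycle_group G (continuous_cochains G T) n\<^esub> f)"

end

theory Submission
  imports Defs
begin

text \<open>
  A class in the kernel is represented by \<open>d\<phi>\<close> with \<open>\<phi>(g, h) = q(g\<inverse> h)\<close> for a continuous
  quasimorphism \<open>q\<close> of \<open>G\<close>, and it suffices to show that \<open>q\<close> is bounded. By compactness, \<open>q\<close> is
  bounded on each set of elements moving the base point \<open>x\<close> a bounded amount. Since \<open>G\<close> is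
  transitive on \<open>\<Lambda>\<close>, a Baire category argument shows that already the elements moving \<open>x\<close> by at
  most some \<open>R\<close> are transitive on \<open>\<Lambda>\<close>. As every \<open>g x\<close> lies close to a ray from \<open>x\<close> to a point of
  \<open>\<Lambda>\<close>, and \<open>d(g x, x) = d(g\<inverse> x, x)\<close>, for each \<open>g\<close> there is an \<open>h\<close> moving \<open>x\<close> a bounded amount with
  \<open>h g x\<close> close to \<open>g\<inverse> x\<close>. Then \<open>h\<close> and \<open>g h g\<close> both move \<open>x\<close> a bounded amount, so \<open>2 q(g)\<close> is
  bounded independently of \<open>g\<close>.
\<close>

section \<open>Gromov products and the four-point inequality\<close>

lemma gromov_product_commute: "gromov_product p x y = gromov_product p y x"
  by (simp add: gromov_product_def dist_commute)

lemma gromov_product_diff_right: "gromov_product p x y \<le> gromov_product p x z + dist y z"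
  using dist_triangle[of p y z] dist_triangle[of x z y]
  by (simp add: gromov_product_def dist_commute field_simps)

lemma gromov_product_diff_base: "gromov_product p x y \<le> gromov_product q x y + dist p q"
  using dist_triangle[of p x q] dist_triangle[of p y q]
  by (simp add: gromov_product_def field_simps)

lemma gromov_product_le_dist: "gromov_product p x y \<le> dist p x"
  using dist_triangle[of p y x] by (simp add: gromov_product_def field_simps)

lemma gromov_product_isometry:
  assumes "\<And>x y. dist (g x) (g y) = dist x y"
  shows "gromov_product (g p) (g x) (g y) = gromov_product p x y"
  by (simp add: gromov_product_def assms)

text \<open>An isometry transports the product to the base point \<open>g p\<close>; returning to
  \<open>p\<close> costs at most the displacement of \<open>p\<close>. This is why displacements of
  the base point are the only constants that group elements contribute later on.\<close>

lemma gromov_product_isometry_fixed_base: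
  assumes "\<And>x y. dist (g x) (g y) = dist x y"
  shows "gromov_product p x y \<le> gromov_product p (g x) (g y) + dist (g p) p"
  using gromov_product_diff_base[of "g p" "g x" "g y" p]
  by (simp add: gromov_product_isometry[OF assms])

lemma dist_le_if_geodesic_segment:
  assumes "geodesic_segment x y S" and "w \<in> S"
  shows "dist x w + dist w y = dist x y"
proof -
  obtain c t where c: "c 0 = x" "c (dist x y) = y"
      "\<forall>s\<in>{0..dist x y}. \<forall>t\<in>{0..dist x y}. dist (c s) (c t) = \<bar>s - t\<bar>"
    and t: "t \<in> {0..dist x y}" "w = c t"
    using assms by (auto simp: geodesic_segment_def)
  have "dist (c 0) (c t) = t" "dist (c t) (c (dist x y)) = dist x y - t"
    using c(3) t(1) by auto
  then show ?thesis
    unfolding c(1,2) t(2) by linarith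
qed

lemma connected_geodesic_segment:
  assumes "geodesic_segment x y S"
  shows "connected S"
proof -
  obtain c where c: "S = c ` {0..dist x y}"
      "\<forall>s\<in>{0..dist x y}. \<forall>t\<in>{0..dist x y}. dist (c s) (c t) = \<bar>s - t\<bar>"
    using assms by (auto simp: geodesic_segment_def)
  have "continuous_on {0..dist x y} c"
    unfolding continuous_on_iff using c(2) by (auto simp: dist_real_def)
  then show ?thesis
    unfolding c(1) by (intro connected_continuous_image) auto
qed

lemma geodesic_segment_ends:
  assumes "geodesic_segment x y S"
  shows "x \<in> S" "y \<in> S"
proof -
  obtain c where c: "c 0 = x" "c (dist x y) = y" "S = c ` {0..dist x y}"
    using assms unfolding geodesic_segment_def by blast
  show "x \<in> S"
    unfolding c(3) by (rule image_eqI[where x = 0]) (simp_all add: c(1))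
  show "y \<in> S"
    unfolding c(3) by (rule image_eqI[where x = "dist x y"]) (simp_all add: c(2))
qed

lemma geodesic_segment_sym:
  assumes "geodesic_segment x y S"
  shows "geodesic_segment y x S"
proof -
  obtain c where c: "c 0 = x" "c (dist x y) = y" "S = c ` {0..dist x y}"
      "\<forall>s\<in>{0..dist x y}. \<forall>t\<in>{0..dist x y}. dist (c s) (c t) = \<bar>s - t\<bar>"
    using assms by (auto simp: geodesic_segment_def)
  have "S = (\<lambda>t. c (dist x y - t)) ` {0..dist x y}"
    unfolding c(3)
  proof (intro equalityI subsetI)
    fix w assume "w \<in> c ` {0..dist x y}"
    then obtain t where "t \<in> {0..dist x y}" "w = c t" by auto
    then show "w \<in> (\<lambda>t. c (dist x y - t)) ` {0..dist x y}"
      by (intro image_eqI[where x = "dist x y - t"]) auto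
  qed auto
  then show ?thesis
    unfolding geodesic_segment_def using c
    by (intro exI[where x = "\<lambda>t. c (dist x y - t)"]) (auto simp: dist_commute)
qed

text \<open>Add the triangle inequalities from \<open>p\<close> through \<open>w\<close> to both
  ends; on a segment the two pieces sum to \<open>dist x y\<close>.\<close>

lemma gromov_product_le_dist_segment:
  assumes "geodesic_segment x y S" and "w \<in> S"
  shows "gromov_product p x y \<le> dist p w"
  using dist_le_if_geodesic_segment[OF assms] dist_triangle[of p x w] dist_triangle[of p y w]
  by (simp add: gromov_product_def dist_commute field_simps)

lemma set_nbhd_Un: "set_nbhd r (A \<union> B) = set_nbhd r A \<union> set_nbhd r B"
  by (auto simp: set_nbhd_def)

lemma open_set_nbhd: "open (set_nbhd r A)"
  by (auto simp: set_nbhd_def)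

text \<open>
  The connected side \<open>[x, z]\<close> is covered by the open neighbourhoods of the other two sides,
  so some point of it is close to both; there the Gromov product is almost attained.
\<close>

lemma exists_dist_segment_le_gromov_product:
  fixes p x z :: "'a::metric_space"
  assumes S: "geodesic_segment x z S" and P: "geodesic_segment p x P"
    and Q: "geodesic_segment p z Q" and "\<delta> > 0" and sub: "S \<subseteq> set_nbhd \<delta> (P \<union> Q)"
  shows "\<exists>w\<in>S. dist p w \<le> gromov_product p x z + 2 * \<delta>"
proof -
  have "x \<in> set_nbhd \<delta> P \<inter> S" "z \<in> set_nbhd \<delta> Q \<inter> S"
    using geodesic_segment_ends[OF P] geodesic_segment_ends[OF Q] geodesic_segment_ends[OF S]
      \<open>\<delta> > 0\<close> by (force simp: set_nbhd_def)+
  then have "set_nbhd \<delta> P \<inter> set_nbhd \<delta> Q \<inter> S \<noteq> {}"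
    using connectedD[OF connected_geodesic_segment[OF S] open_set_nbhd open_set_nbhd, of \<delta> P \<delta> Q]
      sub by (auto simp: set_nbhd_Un)
  then obtain w a b where w: "w \<in> S" and a: "a \<in> P" "dist a w < \<delta>" and b: "b \<in> Q" "dist b w < \<delta>"
    by (auto simp: set_nbhd_def)
  have "dist p x \<ge> dist p w + dist w x - 2 * \<delta>"
    using dist_le_if_geodesic_segment[OF P a(1)] a(2) dist_triangle[of p w a]
      dist_triangle[of w x a] by (simp add: dist_commute)
  moreover have "dist p z \<ge> dist p w + dist w z - 2 * \<delta>"
    using dist_le_if_geodesic_segment[OF Q b(1)] b(2) dist_triangle[of p w b]
      dist_triangle[of w z b] by (simp add: dist_commute)
  ultimately have "dist p w \<le> gromov_product p x z + 2 * \<delta>"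
    using dist_le_if_geodesic_segment[OF S w]
    by (simp add: gromov_product_def dist_commute field_simps)
  then show ?thesis
    using w by blast
qed

text \<open>Slimness is used twice. In the triangle \<open>p\<close>, \<open>x\<close>,
  \<open>z\<close> it gives a point \<open>w\<close> of \<open>[x, z]\<close> whose distance from
  \<open>p\<close> exceeds the product of \<open>x\<close> and \<open>z\<close> by at most
  2\<delta>. In the triangle \<open>x\<close>, \<open>y\<close>, \<open>z\<close> it puts
  \<open>w\<close> within \<delta> of a point of another side, and the distance from
  \<open>p\<close> to that point dominates one of the other two products. The total loss is
  3\<delta>.\<close>

lemma hyperbolic_space_four_point:
  assumes "geodesic_space TYPE('a::metric_space)" and "hyperbolic_space TYPE('a)"
  obtains \<epsilon> where "\<epsilon> > 0"
    and "\<And>p x y z :: 'a.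
      min (gromov_product p x y) (gromov_product p y z) - \<epsilon> \<le> gromov_product p x z"
proof -
  obtain \<delta> where \<delta>: "\<delta> > 0" and slim: "\<And>(x::'a) y z A B C.
      geodesic_segment x y A \<Longrightarrow> geodesic_segment y z B \<Longrightarrow> geodesic_segment z x C \<Longrightarrow>
        A \<subseteq> set_nbhd \<delta> (B \<union> C)"
    using assms(2) unfolding hyperbolic_space_def by meson
  have "min (gromov_product p x y) (gromov_product p y z) - 3 * \<delta> \<le> gromov_product p x z"
    for p x y z :: 'a
  proof -
    obtain S P Q A B where S: "geodesic_segment x z S" and P: "geodesic_segment p x P"
      and Q: "geodesic_segment p z Q" and A: "geodesic_segment x y A" and B: "geodesic_segment y z B"
      using assms(1) by (meson geodesic_space_def)
    have "S \<subseteq> set_nbhd \<delta> (Q \<union> P)"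
      using slim[OF S geodesic_segment_sym[OF Q] P] .
    then obtain w where w: "w \<in> S" "dist p w \<le> gromov_product p x z + 2 * \<delta>"
      using exists_dist_segment_le_gromov_product[OF S P Q \<delta>] by (auto simp: Un_commute)
    have "S \<subseteq> set_nbhd \<delta> (B \<union> A)"
      using slim[OF S geodesic_segment_sym[OF B] geodesic_segment_sym[OF A]] .
    then obtain v where v: "v \<in> A \<or> v \<in> B" "dist v w < \<delta>"
      using w(1) unfolding set_nbhd_def by fastforce
    have "min (gromov_product p x y) (gromov_product p y z) \<le> dist p v"
      using v(1) gromov_product_le_dist_segment[OF A] gromov_product_le_dist_segment[OF B]
      by (auto intro: min.coboundedI1 min.coboundedI2)
    then show ?thesis
      using w(2) v(2) dist_triangle[of p v w] by (simp add: dist_commute)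
  qed
  then show ?thesis
    using that[of "3 * \<delta>"] \<delta> by auto
qed

section \<open>Sequences converging at infinity\<close>

text \<open>A version of \<open>gromov_asymptotic\<close> with a single threshold and a single base
  point. With a constant sequence in one argument it also measures how close a point of the space is
  to a boundary point.\<close>

definition gromov_close :: "'a::metric_space \<Rightarrow> real \<Rightarrow> (nat \<Rightarrow> 'a) \<Rightarrow> (nat \<Rightarrow> 'a) \<Rightarrow> bool" where
  "gromov_close p t u v \<longleftrightarrow> (\<exists>N. \<forall>i\<ge>N. \<forall>j\<ge>N. t \<le> gromov_product p (u i) (v j))"

lemma gromov_close_commute: "gromov_close p t u v \<longleftrightarrow> gromov_close p t v u"
  by (auto simp: gromov_close_def gromov_product_commute)

lemma gromov_close_mono: "gromov_close p t u v \<Longrightarrow> s \<le> t \<Longrightarrow> gromov_close p s u v"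
  unfolding gromov_close_def by fastforce

lemma eventually_sequentially_prod:
  "eventually (\<lambda>(i, j). P i j) (sequentially \<times>\<^sub>F sequentially) \<longleftrightarrow>
     (\<exists>N::nat. \<forall>i\<ge>N. \<forall>j\<ge>N. P i j)"
proof
  assume "eventually (\<lambda>(i, j). P i j) (sequentially \<times>\<^sub>F sequentially)"
  then obtain Pf Pg where ev: "eventually Pf sequentially" "eventually Pg sequentially"
    and imp: "\<forall>x y. Pf x \<longrightarrow> Pg y \<longrightarrow> P x y"
    by (auto simp: eventually_prod_filter)
  then obtain M N where "\<forall>i\<ge>M. Pf i" "\<forall>j\<ge>N. Pg j"
    by (auto simp: eventually_sequentially)
  then show "\<exists>N. \<forall>i\<ge>N. \<forall>j\<ge>N. P i j"
    using imp by (intro exI[where x = "max M N"]) auto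
next
  assume "\<exists>N. \<forall>i\<ge>N. \<forall>j\<ge>N. P i j"
  then obtain N where "\<forall>i\<ge>N. \<forall>j\<ge>N. P i j" by blast
  then show "eventually (\<lambda>(i, j). P i j) (sequentially \<times>\<^sub>F sequentially)"
    unfolding eventually_prod_filter
    by (intro exI[where x = "\<lambda>i. N \<le> i"]) auto
qed

text \<open>A change of base point shifts every threshold by a bounded amount, which is harmless
  when all thresholds are quantified.\<close>

lemma gromov_asymptotic_iff_gromov_close:
  "gromov_asymptotic u v \<longleftrightarrow> (\<forall>t. gromov_close p t u v)"
proof -
  have *: "gromov_close q t u v" if "\<forall>t. gromov_close p t u v" for q t
  proof -
    obtain N where N: "\<forall>i\<ge>N. \<forall>j\<ge>N. t + dist p q \<le> gromov_product p (u i) (v j)"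
      using \<open>\<forall>t. gromov_close p t u v\<close> unfolding gromov_close_def by blast
    have "t \<le> gromov_product q (u i) (v j)" if "i \<ge> N" "j \<ge> N" for i j
      using N that gromov_product_diff_base[of p "u i" "v j" q] by (smt (verit))
    then show ?thesis
      unfolding gromov_close_def by blast
  qed
  have "gromov_asymptotic u v \<longleftrightarrow> (\<forall>q t. gromov_close q t u v)"
    unfolding gromov_asymptotic_def filterlim_at_top gromov_close_def
    by (simp add: case_prod_beta' flip: eventually_sequentially_prod)
  then show ?thesis
    using * by blast
qed

lemma gromov_close_isometry:
  fixes g :: "'a::metric_space \<Rightarrow> 'a"
  assumes "\<And>x y. dist (g x) (g y) = dist x y" and "gromov_close p t u v"
  shows "gromov_close p (t - dist (g p) p) (g \<circ> u) (g \<circ> v)"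
proof -
  obtain N where N: "\<forall>i\<ge>N. \<forall>j\<ge>N. t \<le> gromov_product p (u i) (v j)"
    using assms(2) unfolding gromov_close_def by blast
  have "t - dist (g p) p \<le> gromov_product p (g (u i)) (g (v j))" if "i \<ge> N" "j \<ge> N" for i j
    using N that gromov_product_isometry_fixed_base[where g = g and p = p, OF assms(1)]
    by (smt (verit))
  then show ?thesis
    unfolding gromov_close_def by auto
qed

lemma gromov_asymptotic_commute: "gromov_asymptotic u v \<longleftrightarrow> gromov_asymptotic v u"
  unfolding gromov_asymptotic_iff_gromov_close[where p = undefined]
  by (simp add: gromov_close_commute)

lemma gromov_asymptotic_isometry:
  fixes g :: "'a::metric_space \<Rightarrow> 'a"
  assumes "\<And>x y. dist (g x) (g y) = dist x y" and "gromov_asymptotic u v"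
  shows "gromov_asymptotic (g \<circ> u) (g \<circ> v)"
proof -
  have "gromov_close p t (g \<circ> u) (g \<circ> v)" for p t
    using gromov_close_isometry[where g = g and p = p and t = "t + dist (g p) p" and u = u and v = v]
      assms by (simp add: gromov_asymptotic_iff_gromov_close[where p = p])
  then show ?thesis
    unfolding gromov_asymptotic_iff_gromov_close[where p = undefined] by blast
qed

text \<open>Cluster points replace convergent subsequences, because the lemma is applied in function
  spaces with the product topology, whose index type may be uncountable.\<close>

lemma compact_cluster_point:
  fixes h :: "nat \<Rightarrow> 'b::topological_space"
  assumes "compact S" and "\<And>i. h i \<in> S"
  obtains l where "l \<in> S"
    and "\<And>V. open V \<Longrightarrow> l \<in> V \<Longrightarrow> \<exists>\<^sub>F i in sequentially. h i \<in> V"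
proof -
  have "filtermap h sequentially \<noteq> bot" "eventually (\<lambda>y. y \<in> S) (filtermap h sequentially)"
    using assms(2) by (auto simp: filtermap_bot_iff eventually_filtermap)
  then obtain l where l: "l \<in> S" "inf (nhds l) (filtermap h sequentially) \<noteq> bot"
    using assms(1) unfolding compact_filter by blast
  have "\<exists>\<^sub>F i in sequentially. h i \<in> V" if V: "open V" "l \<in> V" for V
  proof (rule ccontr)
    assume "\<not> (\<exists>\<^sub>F i in sequentially. h i \<in> V)"
    then have "eventually (\<lambda>y. y \<notin> V) (filtermap h sequentially)"
      by (simp add: frequently_def eventually_filtermap)
    moreover have "eventually (\<lambda>y. y \<in> V) (nhds l)"
      using V by (rule eventually_nhds_in_open)
    ultimately have "eventually (\<lambda>_. False) (inf (nhds l) (filtermap h sequentially))"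
      unfolding eventually_inf by blast
    then show False
      using l(2) by (simp add: trivial_limit_def)
  qed
  then show ?thesis
    using l(1) that by blast
qed

section \<open>Closeness and asymptotic sequences under the four-point inequality\<close>

locale four_point_space =
  fixes \<epsilon> :: real and base :: "'a::metric_space"
  assumes eps_pos: "\<epsilon> > 0"
    and four_point: "\<And>p x y z :: 'a.
      min (gromov_product p x y) (gromov_product p y z) - \<epsilon> \<le> gromov_product p x z"
begin

abbreviation close :: "real \<Rightarrow> (nat \<Rightarrow> 'a) \<Rightarrow> (nat \<Rightarrow> 'a) \<Rightarrow> bool" where
  "close \<equiv> gromov_close base"

text \<open>The four-point inequality is applied through one late term of \<open>v\<close>, so every
  passage through an intermediate sequence costs \<epsilon>.\<close>

lemma close_trans:
  assumes "close t u v" and "close s v w" and "r \<le> t - \<epsilon>" and "r \<le> s - \<epsilon>"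
  shows "close r u w"
proof -
  obtain M where M: "\<forall>i\<ge>M. \<forall>j\<ge>M. t \<le> gromov_product base (u i) (v j)"
    using assms(1) unfolding gromov_close_def by blast
  obtain N where N: "\<forall>i\<ge>N. \<forall>j\<ge>N. s \<le> gromov_product base (v i) (w j)"
    using assms(2) unfolding gromov_close_def by blast
  have "r \<le> gromov_product base (u i) (w j)" if "i \<ge> max M N" "j \<ge> max M N" for i j
  proof -
    have "t \<le> gromov_product base (u i) (v (max M N))"
      "s \<le> gromov_product base (v (max M N)) (w j)"
      using M N that by auto
    then show ?thesis
      using four_point[of base "u i" "v (max M N)" "w j"] assms(3,4) by linarith
  qed
  then show ?thesis
    unfolding gromov_close_def by blast
qed

lemma asymptotic_iff_close: "gromov_asymptotic u v \<longleftrightarrow> (\<forall>t. close t u v)"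
  by (rule gromov_asymptotic_iff_gromov_close)

lemma asymptotic_trans:
  fixes u v w :: "nat \<Rightarrow> 'a"
  assumes "gromov_asymptotic u v" and "gromov_asymptotic v w"
  shows "gromov_asymptotic u w"
  unfolding asymptotic_iff_close
proof
  fix t
  show "close t u w"
    by (rule close_trans[where t = "t + \<epsilon>" and s = "t + \<epsilon>" and v = v])
      (use assms in \<open>simp_all add: asymptotic_iff_close\<close>)
qed

lemma close_asymptotic_right:
  assumes "close t u v" and "gromov_asymptotic v w" and "s \<le> t - \<epsilon>"
  shows "close s u w"
  by (rule close_trans[where t = t and s = "s + \<epsilon>" and v = v])
    (use assms in \<open>simp_all add: asymptotic_iff_close\<close>)

abbreviation asymptotic_rel :: "((nat \<Rightarrow> 'a) \<times> (nat \<Rightarrow> 'a)) set" where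
  "asymptotic_rel \<equiv>
     {(u, v). u \<in> gromov_sequences \<and> v \<in> gromov_sequences \<and> gromov_asymptotic u v}"

lemma equiv_asymptotic_rel: "equiv gromov_sequences asymptotic_rel"
proof (rule equivI)
  show "refl_on gromov_sequences asymptotic_rel"
    by (simp add: refl_on_def gromov_sequences_def)
  show "sym asymptotic_rel"
  proof (rule symI)
    fix u v :: "nat \<Rightarrow> 'a" assume "(u, v) \<in> asymptotic_rel"
    then show "(v, u) \<in> asymptotic_rel"
      using gromov_asymptotic_commute[of u v] by simp
  qed
  show "trans asymptotic_rel"
  proof (rule transI)
    fix u v w :: "nat \<Rightarrow> 'a" assume "(u, v) \<in> asymptotic_rel" "(v, w) \<in> asymptotic_rel"
    then show "(u, w) \<in> asymptotic_rel"
      using asymptotic_trans[of u v w] by simp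
  qed
  show "asymptotic_rel \<subseteq> gromov_sequences \<times> gromov_sequences" by auto
qed

lemma boundary_pointD:
  fixes u v :: "nat \<Rightarrow> 'a"
  assumes "\<xi> \<in> gromov_boundary" and "u \<in> \<xi>"
  shows "u \<in> gromov_sequences" and "v \<in> \<xi> \<longleftrightarrow> v \<in> gromov_sequences \<and> gromov_asymptotic u v"
proof -
  obtain w where w: "w \<in> gromov_sequences" "\<xi> = asymptotic_rel `` {w}"
    using assms(1) unfolding gromov_boundary_def by (auto elim!: quotientE)
  then show u: "u \<in> gromov_sequences"
    using assms(2) by auto
  have "gromov_asymptotic w u"
    using w assms(2) by auto
  then have "gromov_asymptotic w v \<longleftrightarrow> gromov_asymptotic u v"
    using asymptotic_trans[of w u v] asymptotic_trans[of u w v] gromov_asymptotic_commute[of w u]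
    by blast
  then show "v \<in> \<xi> \<longleftrightarrow> v \<in> gromov_sequences \<and> gromov_asymptotic u v"
    using w by auto
qed

lemma gromov_boundary_nonempty:
  fixes \<xi> :: "(nat \<Rightarrow> 'a) set"
  assumes "\<xi> \<in> gromov_boundary"
  shows "\<exists>u. u \<in> \<xi>"
proof -
  have "\<xi> \<noteq> {}"
    using assms unfolding gromov_boundary_def by (rule in_quotient_imp_non_empty[OF equiv_asymptotic_rel])
  then show ?thesis
    by blast
qed

lemma boundary_point_of_sequence:
  fixes u :: "nat \<Rightarrow> 'a"
  assumes "u \<in> gromov_sequences"
  obtains \<xi> where "\<xi> \<in> gromov_boundary" and "u \<in> \<xi>"
proof (rule that)
  show "asymptotic_rel `` {u} \<in> gromov_boundary"
    unfolding gromov_boundary_def by (rule quotientI[OF assms])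
  show "u \<in> asymptotic_rel `` {u}"
    by (rule equiv_class_self[OF equiv_asymptotic_rel assms])
qed


section \<open>Neighbourhoods of boundary points and the limit set\<close>

text \<open>Together with \<open>extended_gromov_product_greaterD\<close> this trades the supremum
  of lower limits for \<open>gromov_close\<close> on one pair of representing sequences.\<close>

lemma extended_gromov_product_ge:
  fixes a b :: "'a compactification_point"
  assumes "u \<in> representing_sequences a" and "v \<in> representing_sequences b" and "gromov_close p t u v"
  shows "ereal t \<le> extended_gromov_product p a b"
proof -
  have "ereal t \<le> Liminf (sequentially \<times>\<^sub>F sequentially) (\<lambda>(i, j). ereal (gromov_product p (u i) (v j)))"
  proof (rule Liminf_bounded)
    have "eventually (\<lambda>(i, j). t \<le> gromov_product p (u i) (v j)) (sequentially \<times>\<^sub>F sequentially)"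
      using assms(3) by (simp add: eventually_sequentially_prod gromov_close_def)
    then show "\<forall>\<^sub>F n in sequentially \<times>\<^sub>F sequentially.
        ereal t \<le> (case n of (i, j) \<Rightarrow> ereal (gromov_product p (u i) (v j)))"
      by (rule eventually_mono) auto
  qed
  then show ?thesis
    unfolding extended_gromov_product_def
    using assms(1,2) by (intro SUP_upper2[where i = "(u, v)"]) auto
qed

lemma extended_gromov_product_greaterD:
  fixes a b :: "'a compactification_point"
  assumes "ereal t < extended_gromov_product p a b"
  obtains u v where "u \<in> representing_sequences a" and "v \<in> representing_sequences b"
    and "gromov_close p t u v"
proof -
  obtain u v where uv: "u \<in> representing_sequences a" "v \<in> representing_sequences b"
    and "ereal t < Liminf (sequentially \<times>\<^sub>F sequentially) (\<lambda>(i, j). ereal (gromov_product p (u i) (v j)))"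
    using assms unfolding extended_gromov_product_def by (auto simp: less_SUP_iff)
  then have "eventually (\<lambda>(i, j). t \<le> gromov_product p (u i) (v j)) (sequentially \<times>\<^sub>F sequentially)"
    by (intro eventually_mono[OF less_LiminfD]) auto
  then show ?thesis
    using that uv by (simp add: eventually_sequentially_prod gromov_close_def)
qed

lemma gromov_nbhd_Inr_mem:
  assumes "\<xi> \<in> gromov_boundary" and "u \<in> \<xi>" and "z \<in> compactification_points"
    and "v \<in> representing_sequences z" and "close t u v" and "r < t"
  shows "z \<in> gromov_nbhd base \<xi> r"
  using extended_gromov_product_ge[of u "Inr \<xi>" v z base t] assms
  by (auto simp: gromov_nbhd_def intro: less_le_trans[of _ "ereal t"])

text \<open>A point of the space is represented by all sequences converging to it. At an arbitrarily
  small loss such a sequence may be replaced by the constant one.\<close>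

lemma close_const_limit:
  assumes "close t u v" and "v \<longlonglongrightarrow> y" and "s < t"
  shows "close s u (\<lambda>_. y)"
proof -
  obtain M where M: "\<forall>i\<ge>M. \<forall>j\<ge>M. t \<le> gromov_product base (u i) (v j)"
    using assms(1) unfolding gromov_close_def by blast
  obtain N where N: "\<forall>n\<ge>N. dist (v n) y < t - s"
    using assms(2,3) by (meson LIMSEQ_def diff_gt_0_iff_gt)
  have "s \<le> gromov_product base (u i) y" if "i \<ge> max M N" for i
  proof -
    have "t \<le> gromov_product base (u i) (v (max M N))" "dist (v (max M N)) y < t - s"
      using M N that by auto
    then show ?thesis
      using gromov_product_diff_right[of base "u i" "v (max M N)" y] by linarith
  qed
  then show ?thesis
    unfolding gromov_close_def by blast
qed

lemma close_const_ball:
  assumes "close t u (\<lambda>_. y)" and "dist y z \<le> d"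
  shows "close (t - d) u (\<lambda>_. z)"
proof -
  obtain M where M: "\<forall>i\<ge>M. t \<le> gromov_product base (u i) y"
    using assms(1) unfolding gromov_close_def by blast
  have "t - d \<le> gromov_product base (u i) z" if "i \<ge> M" for i
    using M that gromov_product_diff_right[of base "u i" y z] assms(2) by force
  then show ?thesis
    unfolding gromov_close_def by blast
qed

text \<open>
  The sets \<open>gromov_nbhd base \<xi> r\<close> need not be open, but they are neighbourhoods of \<open>\<xi>\<close>.
\<close>

lemma gromov_nbhd_contains_open:
  fixes \<xi> :: "(nat \<Rightarrow> 'a) set"
  assumes "\<xi> \<in> gromov_boundary"
  obtains U where "compactification_open U" and "Inr \<xi> \<in> U"
    and "\<And>y. Inl y \<in> U \<Longrightarrow> Inl y \<in> gromov_nbhd base \<xi> r"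
proof -
  define N where "N = gromov_nbhd base \<xi> r"
  \<comment> \<open>The candidate for the interior of \<open>N\<close>: the points around which
    \<open>N\<close> contains a metric ball or a whole Gromov neighbourhood.\<close>
  define U where "U = Inl ` interior {y. Inl y \<in> N} \<union>
    {Inr \<zeta> |\<zeta>. \<zeta> \<in> gromov_boundary \<and> (\<exists>s. gromov_nbhd base \<zeta> s \<subseteq> N)}"
  have "\<exists>s. gromov_nbhd p \<zeta> s \<subseteq> U" if mem: "Inr \<zeta> \<in> U" for p \<zeta>
  proof -
    obtain s where \<zeta>: "\<zeta> \<in> gromov_boundary" and s: "gromov_nbhd base \<zeta> s \<subseteq> N"
      using mem unfolding U_def by blast
    \<comment> \<open>The term \<open>dist p base\<close> pays for the change of base point and
      2\<epsilon> for two passages through intermediate sequences. The remaining 3 leaves room for a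
      limit point \<open>y\<close>, for the unit ball around it, and for the strict inequality in
      \<open>gromov_nbhd\<close>.\<close>
    define s' where "s' = s + 2 * \<epsilon> + 3 + dist p base"
    have "z \<in> U" if "z \<in> gromov_nbhd p \<zeta> s'" for z
    proof -
      have z: "z \<in> compactification_points" "ereal s' < extended_gromov_product p (Inr \<zeta>) z"
        using that by (auto simp: gromov_nbhd_def)
      obtain u v where u: "u \<in> \<zeta>" and v: "v \<in> representing_sequences z" and "gromov_close p s' u v"
        using extended_gromov_product_greaterD[OF z(2)] by auto
      then obtain M where M: "\<And>i j. i \<ge> M \<Longrightarrow> j \<ge> M \<Longrightarrow> s' \<le> gromov_product p (u i) (v j)"
        unfolding gromov_close_def by blast
      have "s + 2 * \<epsilon> + 3 \<le> gromov_product base (u i) (v j)" if "i \<ge> M" "j \<ge> M" for i j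
        using M[OF that] gromov_product_diff_base[of p "u i" "v j" base] by (simp add: s'_def)
      then have uv: "close (s + 2 * \<epsilon> + 3) u v"
        unfolding gromov_close_def by blast
      show ?thesis
      proof (cases z)
        case (Inl y)
        then have y: "close (s + 2) u (\<lambda>_. y)"
          using close_const_limit[OF uv, of y "s + 2"] v eps_pos by simp
        have "Inl y' \<in> N" if "y' \<in> ball y 1" for y'
        proof -
          have "close (s + 1) u (\<lambda>_. y')"
            using close_const_ball[OF y, of y' 1] that by (simp add: algebra_simps)
          then have "Inl y' \<in> gromov_nbhd base \<zeta> s"
            using gromov_nbhd_Inr_mem[OF \<zeta> u, of "Inl y'" "\<lambda>_. y'" "s + 1" s]
            by (simp add: compactification_points_def)
          then show ?thesis
            using s by blast
        qed
        then have "y \<in> interior {y. Inl y \<in> N}"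
          by (intro interiorI[of "ball y 1"]) auto
        then show ?thesis
          by (simp add: U_def Inl)
      next
        case (Inr \<zeta>')
        then have \<zeta>': "\<zeta>' \<in> gromov_boundary" and v': "v \<in> \<zeta>'"
          using z(1) v by (auto simp: compactification_points_def)
        have "z' \<in> gromov_nbhd base \<zeta> s" if "z' \<in> gromov_nbhd base \<zeta>' (s + 2 * \<epsilon> + 3)" for z'
        proof -
          have z': "z' \<in> compactification_points"
            "ereal (s + 2 * \<epsilon> + 3) < extended_gromov_product base (Inr \<zeta>') z'"
            using that by (auto simp: gromov_nbhd_def)
          obtain u' w where u': "u' \<in> \<zeta>'" and w: "w \<in> representing_sequences z'"
            and u'w: "close (s + 2 * \<epsilon> + 3) u' w"
            using extended_gromov_product_greaterD[OF z'(2)] by auto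
          have "gromov_asymptotic v u'"
            using boundary_pointD(2)[OF \<zeta>' v'] u' by blast
          then have "close (s + \<epsilon> + 3) u u'"
            using close_asymptotic_right[OF uv] by simp
          then have "close (s + 3) u w"
            using close_trans[OF _ u'w, of "s + \<epsilon> + 3" u "s + 3"] eps_pos by simp
          then show ?thesis
            using gromov_nbhd_Inr_mem[OF \<zeta> u z'(1) w] by simp
        qed
        then have "gromov_nbhd base \<zeta>' (s + 2 * \<epsilon> + 3) \<subseteq> N"
          using s by blast
        then show ?thesis
          using \<zeta>' Inr unfolding U_def by blast
      qed
    qed
    then show ?thesis by blast
  qed
  moreover have "{x. Inl x \<in> U} = interior {y. Inl y \<in> N}"
    by (auto simp: U_def)
  ultimately have "compactification_open U"
    unfolding compactification_open_def by (auto simp: U_def compactification_points_def)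
  moreover have "Inr \<xi> \<in> U"
    using assms by (auto simp: U_def N_def)
  moreover have "Inl y \<in> gromov_nbhd base \<xi> r" if "Inl y \<in> U" for y
    using that interior_subset by (auto simp: U_def N_def)
  ultimately show ?thesis
    using that by blast
qed

text \<open>Replaces accumulation in the compactification by honest sequences of orbit points. Orbit
  points chosen in smaller and smaller neighbourhoods of \<xi> form a sequence of the class \<xi>;
  conversely, late terms of an orbit sequence in \<xi> enter every neighbourhood of \<xi>.\<close>

lemma limit_set_iff:
  fixes \<xi> :: "(nat \<Rightarrow> 'a) set"
  assumes \<xi>: "\<xi> \<in> gromov_boundary"
  shows "\<xi> \<in> limit_set G x \<longleftrightarrow> (\<exists>u\<in>\<xi>. range u \<subseteq> (\<lambda>g. g x) ` G)"
proof
  assume lim: "\<xi> \<in> limit_set G x"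
  obtain u where u: "u \<in> \<xi>"
    using gromov_boundary_nonempty[OF \<xi>] by blast
  have "\<exists>y\<in>(\<lambda>g. g x) ` G. close n u (\<lambda>_. y)" for n
  proof -
    obtain U where U: "compactification_open U" "Inr \<xi> \<in> U"
      and sub: "\<And>y. Inl y \<in> U \<Longrightarrow> Inl y \<in> gromov_nbhd base \<xi> (n + \<epsilon> + 1)"
      using gromov_nbhd_contains_open[OF \<xi>, where r = "n + \<epsilon> + 1"] by blast
    have "Inr \<xi> \<in> gromov_compactification derived_set_of (\<lambda>g. Inl (g x)) ` G"
      using lim by (simp add: limit_set_def)
    then obtain g where g: "g \<in> G" "Inl (g x) \<in> U"
      using U by (auto simp: in_derived_set_of openin_gromov_compactification)
    then obtain u' v where u': "u' \<in> \<xi>" and v: "v \<longlonglongrightarrow> g x" "close (n + \<epsilon> + 1) u' v"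
      using sub[OF g(2)] extended_gromov_product_greaterD
      by (force simp: gromov_nbhd_def)
    have "gromov_asymptotic u u'"
      using boundary_pointD(2)[OF \<xi> u] u' by blast
    moreover have "close (n + \<epsilon>) u' (\<lambda>_. g x)"
      using close_const_limit[OF v(2,1)] by simp
    ultimately have "close n u (\<lambda>_. g x)"
      using close_trans[where t = "n + \<epsilon>" and s = "n + \<epsilon>" and v = u' and u = u and r = n]
      by (simp add: asymptotic_iff_close)
    then show ?thesis
      using g by blast
  qed
  then have "\<exists>y. \<forall>n :: nat. y n \<in> (\<lambda>g. g x) ` G \<and> close (real n) u (\<lambda>_. y n)"
    by (intro choice) blast
  then obtain y where y: "\<And>n. y n \<in> (\<lambda>g. g x) ` G" "\<And>n :: nat. close (real n) u (\<lambda>_. y n)"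
    by blast
  have "gromov_asymptotic u y"
    unfolding asymptotic_iff_close
  proof
    fix t
    have "gromov_asymptotic u u"
      using boundary_pointD(1)[OF \<xi> u] by (simp add: gromov_sequences_def)
    then obtain M where M: "\<And>i j. i \<ge> M \<Longrightarrow> j \<ge> M \<Longrightarrow> t + \<epsilon> \<le> gromov_product base (u i) (u j)"
      unfolding asymptotic_iff_close gromov_close_def by meson
    have "t \<le> gromov_product base (u i) (y n)" if i: "i \<ge> max M (nat \<lceil>t + \<epsilon>\<rceil>)"
        and n: "n \<ge> max M (nat \<lceil>t + \<epsilon>\<rceil>)" for i n
    proof -
      \<comment> \<open>The terms of \<open>u\<close> are close to \<open>y n\<close> only from an
        index \<open>K\<close> depending on \<open>n\<close>. A term of \<open>u\<close> beyond
        \<open>K\<close> therefore serves as intermediate point, while the bound on \<open>i\<close>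
        stays uniform.\<close>
      obtain K where K: "\<And>i. i \<ge> K \<Longrightarrow> real n \<le> gromov_product base (u i) (y n)"
        using y(2)[of n] unfolding gromov_close_def by blast
      have "t + \<epsilon> \<le> real n"
        using n by linarith
      then show ?thesis
        using K[of "max K M"] M[of i "max K M"] i four_point[of base "u i" "u (max K M)" "y n"]
        by (simp add: min_def split: if_splits)
    qed
    then show "close t u y"
      unfolding gromov_close_def by blast
  qed
  moreover from this have "gromov_asymptotic y y"
    using asymptotic_trans gromov_asymptotic_commute by blast
  ultimately have "y \<in> \<xi>"
    using boundary_pointD(2)[OF \<xi> u, of y] by (simp add: gromov_sequences_def)
  then show "\<exists>u\<in>\<xi>. range u \<subseteq> (\<lambda>g. g x) ` G"
    using y(1) by blast
next
  assume "\<exists>u\<in>\<xi>. range u \<subseteq> (\<lambda>g. g x) ` G"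
  then obtain u where u: "u \<in> \<xi>" "range u \<subseteq> (\<lambda>g. g x) ` G" by blast
  have "\<exists>y\<in>(\<lambda>g. Inl (g x)) ` G. y \<in> U" if U: "compactification_open U" "Inr \<xi> \<in> U" for U
  proof -
    obtain r where r: "gromov_nbhd base \<xi> r \<subseteq> U"
      using U unfolding compactification_open_def by blast
    obtain M where M: "\<And>i j. i \<ge> M \<Longrightarrow> j \<ge> M \<Longrightarrow> r + 1 \<le> gromov_product base (u i) (u j)"
      using boundary_pointD(1)[OF \<xi> u(1)]
      unfolding gromov_sequences_def asymptotic_iff_close gromov_close_def by blast
    then have "close (r + 1) u (\<lambda>_. u M)"
      unfolding gromov_close_def by blast
    then have "Inl (u M) \<in> gromov_nbhd base \<xi> r"
      using gromov_nbhd_Inr_mem[OF \<xi> u(1), of "Inl (u M)" "\<lambda>_. u M"]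
      by (simp add: compactification_points_def)
    then show ?thesis
      using r u(2) by blast
  qed
  then show "\<xi> \<in> limit_set G x"
    using \<xi> unfolding limit_set_def in_derived_set_of topspace_gromov_compactification
      openin_gromov_compactification
    by (auto simp: compactification_points_def) blast
qed

end

section \<open>Compactness\<close>

locale proper_four_point_space = four_point_space +
  assumes proper: "proper_space TYPE('a)" and geodesic: "geodesic_space TYPE('a)"
begin

text \<open>Tychonoff's theorem, the factors being closed balls of a proper space.\<close>

lemma compact_pointwise_bounded: "compact {f :: 'b \<Rightarrow> 'a. \<forall>y. f y \<in> cball base (r y)}"
proof -
  have "compactin (product_topology (\<lambda>_. euclidean) UNIV) (PiE UNIV (\<lambda>y. cball base (r y)))"
    using proper by (simp add: compactin_PiE proper_space_def)
  moreover have "PiE UNIV (\<lambda>y. cball base (r y)) = {f :: 'b \<Rightarrow> 'a. \<forall>y. f y \<in> cball base (r y)}"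
    by (auto simp: PiE_def)
  ultimately show ?thesis
    by (simp add: euclidean_product_topology)
qed

lemma geodesic_point:
  assumes "0 \<le> m" and "m \<le> dist base (y :: 'a)"
  shows "\<exists>z. dist base z = m \<and> gromov_product base z y = m"
proof -
  obtain c where c: "c 0 = base" "c (dist base y) = y"
      "\<forall>s\<in>{0..dist base y}. \<forall>t\<in>{0..dist base y}. dist (c s) (c t) = \<bar>s - t\<bar>"
    using geodesic by (metis geodesic_segment_def geodesic_space_def)
  have "dist (c 0) (c m) = m" "dist (c m) (c (dist base y)) = dist base y - m"
    using c(3) assms by auto
  then show ?thesis
    using c by (intro exI[where x = "c m"]) (simp add: gromov_product_def)
qed

text \<open>Sequential compactness at infinity, keeping track of the set \<open>Y\<close> of
  admissible terms. A far term \<open>y i\<close> of each sequence is joined to \<open>base\<close>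
  by a geodesic marked at integer distances. The markings cluster by Tychonoff's theorem, and the
  \<open>y i\<close> whose markings approximate the cluster point on longer and longer initial parts
  form the limit sequence.\<close>

lemma exists_cluster_sequence:
  fixes w :: "nat \<Rightarrow> nat \<Rightarrow> 'a"
  assumes "\<And>i. w i \<in> gromov_sequences" and sub: "\<And>i. range (w i) \<subseteq> Y"
  obtains v where "v \<in> gromov_sequences" and "range v \<subseteq> Y"
    and "\<And>t. \<exists>\<^sub>F i in sequentially. close t (w i) v"
proof -
  have "\<exists>k. \<forall>j\<ge>k. real i \<le> gromov_product base (w i j) (w i k)" for i
    using assms(1)[of i] unfolding gromov_sequences_def asymptotic_iff_close gromov_close_def by blast
  then obtain k where k: "\<And>i j. j \<ge> k i \<Longrightarrow> real i \<le> gromov_product base (w i j) (w i (k i))"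
    by metis
  define y where "y i = w i (k i)" for i
  have y: "real i \<le> gromov_product base (w i j) (y i)" if "j \<ge> k i" for i j
    using k that by (simp add: y_def)
  have y_far: "real i \<le> dist base (y i)" for i
    using k[of i "k i"] gromov_product_le_dist[of base "y i" "y i"] by (simp add: y_def)
  \<comment> \<open>\<open>z\<close> is the mark at distance \<open>m\<close> on a geodesic towards
    \<open>y i\<close>. For \<open>m > i\<close> the geodesic may be too short; then only the bound
    needed for compactness is kept, and \<open>base\<close> itself will do.\<close>
  define Q where "Q i m z \<longleftrightarrow> dist base z \<le> real m \<and>
      (m \<le> i \<longrightarrow> dist base z = real m \<and> gromov_product base z (y i) = real m)" for i m z
  have "\<exists>z. Q i m z" for i m
  proof (cases "m \<le> i")
    case True
    then have "real m \<le> dist base (y i)"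
      using y_far[of i] by linarith
    then obtain z where "dist base z = real m" "gromov_product base z (y i) = real m"
      using geodesic_point[of "real m" "y i"] by auto
    then show ?thesis
      by (intro exI[where x = z]) (simp add: Q_def)
  next
    case False
    then show ?thesis
      by (intro exI[where x = base]) (simp add: Q_def)
  qed
  then obtain c where "\<And>i m. Q i m (c i m)"
    by metis
  then have c: "\<And>i m. dist base (c i m) \<le> real m"
    "\<And>i m. m \<le> i \<Longrightarrow> dist base (c i m) = real m \<and> gromov_product base (c i m) (y i) = real m"
    by (simp_all add: Q_def)
  have "c i \<in> {f. \<forall>m. f m \<in> cball base (real m)}" for i
    using c(1) by simp
  then obtain l where l: "\<And>V. open V \<Longrightarrow> l \<in> V \<Longrightarrow> \<exists>\<^sub>F i in sequentially. c i \<in> V"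
    using compact_cluster_point[where h = c, OF compact_pointwise_bounded[of real]] by blast
  have "\<exists>i\<ge>n. \<forall>m\<le>n. dist (c i m) (l m) < 1" for n
  proof -
    \<comment> \<open>Only finitely many coordinates are constrained, so this is open in the product
      topology.\<close>
    have "open (\<Inter>m\<in>{..n}. {f :: nat \<Rightarrow> 'a. dist (f m) (l m) < 1})"
      by (intro open_INT finite_atMost ballI open_Collect_less continuous_intros)
        (rule continuous_on_product_coordinates)
    then have "\<exists>\<^sub>F i in sequentially. c i \<in> (\<Inter>m\<in>{..n}. {f. dist (f m) (l m) < 1})"
      by (rule l) simp
    then show ?thesis
      by (force simp: frequently_sequentially)
  qed
  then obtain s where s: "\<And>n. s n \<ge> n" "\<And>n m. m \<le> n \<Longrightarrow> dist (c (s n) m) (l m) < 1"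
    by metis
  define v where "v n = y (s n)" for n
  \<comment> \<open>The path runs from \<open>v n\<close> through the marks \<open>a\<close> and
    \<open>b\<close> at distance \<open>m\<close> to \<open>v n'\<close>. The two intermediate
    points cost 2\<epsilon>, and the gap of less than 2 between the marks costs 1.\<close>
  have v: "real m - 2 * \<epsilon> - 1 \<le> gromov_product base (v n) (v n')" if "m \<le> n" "m \<le> n'" for m n n'
  proof -
    define a b where "a = c (s n) m" and "b = c (s n') m"
    have "gromov_product base (v n) a = real m" "dist base a = real m"
      "gromov_product base b (v n') = real m" "dist base b = real m"
      using c(2)[of m "s n"] c(2)[of m "s n'"] that s(1)[of n] s(1)[of n']
      by (auto simp: a_def b_def v_def gromov_product_commute)
    moreover have "dist a b < 2"
      using s(2)[OF that(1)] s(2)[OF that(2)] dist_triangle2[of a b "l m"]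
      by (simp add: a_def b_def)
    then have "real m - 1 \<le> gromov_product base a b"
      using calculation by (simp add: gromov_product_def field_simps)
    ultimately show ?thesis
      using four_point[of base "v n" a "v n'"] four_point[of base a b "v n'"] eps_pos by linarith
  qed
  have "gromov_asymptotic v v"
    unfolding asymptotic_iff_close
  proof
    fix t
    define m where "m = nat \<lceil>t + 2 * \<epsilon> + 1\<rceil>"
    have "t \<le> real m - 2 * \<epsilon> - 1"
      unfolding m_def by linarith
    then have "\<forall>n\<ge>m. \<forall>n'\<ge>m. t \<le> gromov_product base (v n) (v n')"
      using v by (meson order_trans)
    then show "close t v v"
      unfolding gromov_close_def by blast
  qed
  moreover have "range v \<subseteq> Y"
    using sub by (auto simp: v_def y_def)
  moreover have "\<exists>\<^sub>F i in sequentially. close t (w i) v" for t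
    unfolding frequently_sequentially
  proof
    fix N :: nat
    \<comment> \<open>One \<epsilon> more than the loss within \<open>v\<close>, for the passage
      through \<open>v n\<close>.\<close>
    define m where "m = nat \<lceil>t + 3 * \<epsilon> + 1\<rceil>"
    define n where "n = max N m"
    have m: "t + 3 * \<epsilon> + 1 \<le> real m"
      unfolding m_def by linarith
    have "t \<le> gromov_product base (w (s n) j) (v j')" if "j \<ge> k (s n)" "j' \<ge> m" for j j'
    proof -
      have "real (s n) \<le> gromov_product base (w (s n) j) (v n)"
        using y that(1) by (simp add: v_def)
      moreover have "real m \<le> real (s n)"
        using s(1)[of n] by (simp add: n_def)
      moreover have "real m - 2 * \<epsilon> - 1 \<le> gromov_product base (v n) (v j')"
        using v[of m n j'] that(2) by (simp add: n_def)
      ultimately show ?thesis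
        using four_point[of base "w (s n) j" "v n" "v j'"] m eps_pos by linarith
    qed
    then have "close t (w (s n)) v"
      unfolding gromov_close_def by (intro exI[where x = "max (k (s n)) m"]) auto
    then show "\<exists>i\<ge>N. close t (w i) v"
      using s(1)[of n] by (intro exI[where x = "s n"]) (simp add: n_def)
  qed
  ultimately show ?thesis
    using that gromov_sequences_def by blast
qed


text \<open>
  Recording an isometry together with its inverse turns surjectivity, which is not closed under
  pointwise convergence in itself, into the closed condition \<open>dist (h x) y = dist x (f y)\<close>.
\<close>

lemma compact_isometry_ball:
  "compact {f :: 'a \<Rightarrow> 'a. f \<in> carrier isometry_group \<and> dist (f base) base \<le> r}"
proof -
  define P where "P = {p :: ('a \<Rightarrow> 'a) \<times> ('a \<Rightarrow> 'a). dist (fst p base) base \<le> r \<and>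
    (\<forall>x y. dist (snd p x) y = dist x (fst p y))}"
  define K where "K = {f :: 'a \<Rightarrow> 'a. \<forall>y. f y \<in> cball base (r + dist base y)}"
  have inv: "h (f x) = x" "f (h x) = x" "dist (f x) (f y) = dist x y"
    if "(f, h) \<in> P" for f h x y
  proof -
    have *: "dist (h x) y = dist x (f y)" for x y
      using that by (simp add: P_def)
    show hf: "h (f x) = x" for x
      using *[of "f x" x] by simp
    show "f (h x) = x"
      using *[of x "h x"] by simp
    show "dist (f x) (f y) = dist x y"
      using *[of "f x" y] hf by simp
  qed
  have c: "continuous_on UNIV (\<lambda>p :: ('a \<Rightarrow> 'a) \<times> ('a \<Rightarrow> 'a). fst p x)"
      "continuous_on UNIV (\<lambda>p :: ('a \<Rightarrow> 'a) \<times> ('a \<Rightarrow> 'a). snd p x)" for x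
    by (rule continuous_on_product_then_coordinatewise, intro continuous_intros)+
  have "closed P"
    unfolding P_def
    by (intro closed_Collect_conj closed_Collect_all closed_Collect_le closed_Collect_eq
        continuous_on_dist continuous_on_const c)
  have "P \<subseteq> K \<times> K"
  proof
    fix p assume p: "p \<in> P"
    obtain f h where fh: "p = (f, h)" by force
    have "dist base (f y) \<le> r + dist base y" for y
      using inv(3)[of f h base y] p dist_triangle[of base "f y" "f base"]
      by (simp add: fh P_def dist_commute)
    moreover have "dist base (h y) \<le> r + dist base y" for y
    proof -
      have "dist (h y) base = dist y (f base)" "dist (f base) base \<le> r"
        using p by (simp_all add: fh P_def)
      then show ?thesis
        using dist_triangle[of y "f base" base] by (simp add: dist_commute)
    qed
    ultimately show "p \<in> K \<times> K"
      by (simp add: K_def fh)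
  qed
  moreover have "compact (K \<times> K)"
    unfolding K_def by (intro compact_Times compact_pointwise_bounded)
  ultimately have "compact P"
    using \<open>closed P\<close> compact_Int_closed[of "K \<times> K" P] by (simp add: Int_absorb1)
  then have "compact (fst ` P)"
    by (intro compact_continuous_image continuous_on_fst continuous_on_id)
  moreover have "fst ` P = {f. f \<in> carrier isometry_group \<and> dist (f base) base \<le> r}"
  proof (intro equalityI subsetI)
    fix f assume "f \<in> fst ` P"
    then obtain h where fh: "(f, h) \<in> P" by auto
    have "surj f"
      using inv(2)[OF fh] by (metis surjI)
    then show "f \<in> {f. f \<in> carrier isometry_group \<and> dist (f base) base \<le> r}"
      using inv(3)[OF fh] fh by (auto simp: isometry_group_def P_def)
  next
    fix f :: "'a \<Rightarrow> 'a" assume "f \<in> {f. f \<in> carrier isometry_group \<and> dist (f base) base \<le> r}"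
    then have f: "surj f" "\<And>x y. dist (f x) (f y) = dist x y" "dist (f base) base \<le> r"
      by (auto simp: isometry_group_def)
    have "dist (inv_into UNIV f x) y = dist x (f y)" for x y
      using f(2)[of "inv_into UNIV f x" y] by (simp add: surj_f_inv_f[OF f(1)])
    then have "(f, inv_into UNIV f) \<in> P"
      using f(3) by (simp add: P_def)
    then show "f \<in> fst ` P"
      by force
  qed
  ultimately show ?thesis by simp
qed

end

section \<open>Compact-open topology and pointwise convergence of isometries\<close>

text \<open>Isometries do not increase distances, so control on a finite \<open>e / 3\<close>-net of
  \<open>K\<close> gives control on all of \<open>K\<close>. The lemma carries pointwise compact
  sets to compact sets of \<open>isometry_topology\<close> and pulls closed sets back.\<close>

lemma continuous_map_pointwise_isometry_topology:
  "continuous_map (top_of_set (carrier isometry_group)) isometry_topology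
     (id :: ('a::metric_space \<Rightarrow> 'a) \<Rightarrow> 'a \<Rightarrow> 'a)"
  unfolding isometry_topology_def
proof (rule continuous_on_generated_topo)
  fix W :: "('a \<Rightarrow> 'a) set"
  assume "W \<in> {{f \<in> carrier isometry_group. f ` K \<subseteq> U} |K U. compact K \<and> open U}"
  then obtain K U where W: "W = {f \<in> carrier isometry_group. f ` K \<subseteq> U}"
    and K: "compact K" and U: "open U" by blast
  have "\<exists>V. open V \<and> f \<in> V \<and> V \<inter> carrier isometry_group \<subseteq> W" if f: "f \<in> W" for f
  proof -
    have iso: "dist (f x) (f y) = dist x y" for x y
      using f by (simp add: W isometry_group_def)
    have "continuous_on K f"
      unfolding continuous_on_iff by (auto simp: iso)
    then have "compact (f ` K)"
      using K by (rule compact_continuous_image)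
    then obtain e where e: "e > 0" "(\<Union>y\<in>f ` K. ball y e) \<subseteq> U"
      using compact_subset_open_imp_ball_epsilon_subset[of "f ` K" U] U f by (auto simp: W)
    obtain F where F: "finite F" "F \<subseteq> K" "K \<subseteq> (\<Union>k\<in>F. ball k (e / 3))"
      using compactE_image[OF K, of K "\<lambda>k. ball k (e / 3)"] e(1) by force
    define V where "V = (\<Inter>k\<in>F. {g :: 'a \<Rightarrow> 'a. dist (g k) (f k) < e / 3})"
    have "open V"
      unfolding V_def using F(1)
      by (intro open_INT ballI open_Collect_less continuous_on_dist continuous_on_const
          continuous_on_product_coordinates)
    moreover have "f \<in> V"
      using e(1) by (simp add: V_def)
    moreover have "g \<in> W" if g: "g \<in> V" "g \<in> carrier isometry_group" for g
    proof -
      have "g x \<in> U" if x: "x \<in> K" for x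
      proof -
        obtain k where k: "k \<in> F" "dist k x < e / 3"
          using F(3) x by auto
        have "dist (g k) (f k) < e / 3" "dist (g k) (g x) < e / 3" "dist (f k) (f x) < e / 3"
          using g k by (auto simp: V_def isometry_group_def iso)
        then have "dist (f x) (g x) < e"
          using dist_triangle[of "f x" "g x" "f k"] dist_triangle[of "f k" "g x" "g k"]
          by (simp add: dist_commute)
        then show ?thesis
          using e(2) x by force
      qed
      then show ?thesis
        using g(2) by (auto simp: W)
    qed
    ultimately show ?thesis
      by (intro exI[where x = V]) blast
  qed
  then have "\<exists>T. openin (top_of_set (carrier isometry_group)) T \<and> f \<in> T \<and> T \<subseteq> W"
    if f: "f \<in> W" for f
  proof -
    obtain V where "open V" "f \<in> V" "V \<inter> carrier isometry_group \<subseteq> W"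
      using \<open>\<And>f. f \<in> W \<Longrightarrow> \<exists>V. open V \<and> f \<in> V \<and> V \<inter> carrier isometry_group \<subseteq> W\<close>[OF f]
      by blast
    then show ?thesis
      using f openin_open_Int[of V "carrier isometry_group"]
      by (intro exI[where x = "carrier isometry_group \<inter> V"]) (auto simp: W)
  qed
  then have "openin (top_of_set (carrier isometry_group)) W"
    by (subst openin_subopen) blast
  moreover have "id -` W \<inter> topspace (top_of_set (carrier isometry_group)) = W"
    by (auto simp: W)
  ultimately show "openin (top_of_set (carrier isometry_group))
      (id -` W \<inter> topspace (top_of_set (carrier isometry_group)))"
    by simp
next
  \<comment> \<open>The empty compact set makes the whole carrier one of the generators.\<close>
  show "id ` topspace (top_of_set (carrier isometry_group)) \<subseteq>
    \<Union>{{f \<in> carrier isometry_group. f ` K \<subseteq> U} |K U. compact K \<and> open (U :: 'a set)}"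
    by (auto intro!: exI[where x = "{}"])
qed

lemma group_isometry_group: "group (isometry_group :: ('a::metric_space \<Rightarrow> 'a) monoid)"
proof (rule groupI)
  fix f :: "'a \<Rightarrow> 'a" assume "f \<in> carrier isometry_group"
  then have f: "surj f" "\<And>x y. dist (f x) (f y) = dist x y"
    by (auto simp: isometry_group_def)
  have "dist (inv_into UNIV f x) (inv_into UNIV f y) = dist x y" for x y
    using f(2)[of "inv_into UNIV f x" "inv_into UNIV f y"] by (simp add: surj_f_inv_f[OF f(1)])
  moreover have "inj f"
    by (rule injI) (metis f(2) dist_eq_0_iff)
  ultimately show "\<exists>h\<in>carrier isometry_group. h \<otimes>\<^bsub>isometry_group\<^esub> f = \<one>\<^bsub>isometry_group\<^esub>"
    by (intro bexI[where x = "inv_into UNIV f"]) (auto simp: isometry_group_def inj_imp_surj_inv)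
next
  fix f h :: "'a \<Rightarrow> 'a" assume "f \<in> carrier isometry_group" "h \<in> carrier isometry_group"
  then show "f \<otimes>\<^bsub>isometry_group\<^esub> h \<in> carrier isometry_group"
    using comp_surj[of h f] by (simp add: isometry_group_def)
qed (auto simp: isometry_group_def)

section \<open>Uniform transitivity on the limit set\<close>

text \<open>By \<open>limit_set_iff\<close> these sequences represent exactly the limit points.
  Working with representatives avoids equivalence classes until the final theorem.\<close>

definition orbit_sequences :: "('a::metric_space \<Rightarrow> 'a) set \<Rightarrow> 'a \<Rightarrow> (nat \<Rightarrow> 'a) set" where
  "orbit_sequences G x = {u \<in> gromov_sequences. range u \<subseteq> (\<lambda>g. g x) ` G}"

locale closed_isometry_group = proper_four_point_space +
  fixes G :: "('a \<Rightarrow> 'a) set"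
  assumes subgroup: "subgroup G isometry_group" and closed: "closedin isometry_topology G"
begin

lemma dist_G: "g \<in> G \<Longrightarrow> dist (g x) (g y) = dist x y"
  using subgroup.subset[OF subgroup] by (auto simp: isometry_group_def)

lemma comp_G: "g \<in> G \<Longrightarrow> h \<in> G \<Longrightarrow> g \<circ> h \<in> G"
  using subgroup.m_closed[OF subgroup] by (simp add: isometry_group_def)

lemma inverse_G:
  assumes "g \<in> G"
  shows "\<exists>h\<in>G. h \<circ> g = id \<and> g \<circ> h = id"
proof -
  have "g \<in> carrier isometry_group"
    using subgroup.subset[OF subgroup] assms by blast
  then have "m_inv isometry_group g \<circ> g = id" "g \<circ> m_inv isometry_group g = id"
    using group.l_inv[OF group_isometry_group, of g] group.r_inv[OF group_isometry_group, of g]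
    by (simp_all add: isometry_group_def)
  then show ?thesis
    using subgroup.m_inv_closed[OF subgroup assms] by blast
qed

text \<open>A compact exhaustion of \<open>G\<close> that keeps track of constants: radii add under
  composition and are preserved by inversion.\<close>

definition orbit_ball :: "real \<Rightarrow> ('a \<Rightarrow> 'a) set" where
  "orbit_ball r = {g \<in> G. dist (g base) base \<le> r}"

text \<open>\<open>G\<close> is closed in \<open>isometry_topology\<close>, hence also for pointwise
  convergence of isometries, so it cuts out a closed part of the compact set of
  \<open>compact_isometry_ball\<close>.\<close>

lemma compact_orbit_ball: "compact (orbit_ball r)"
proof -
  have "closedin (top_of_set (carrier isometry_group))
      {f \<in> topspace (top_of_set (carrier isometry_group)). id f \<in> G}"
    by (rule closedin_continuous_map_preimage[OF continuous_map_pointwise_isometry_topology closed])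
  then obtain T where T: "closed T" "{f \<in> carrier isometry_group. f \<in> G} = carrier isometry_group \<inter> T"
    by (auto simp: closedin_closed)
  have "orbit_ball r = {f. f \<in> carrier isometry_group \<and> dist (f base) base \<le> r} \<inter> T"
    using T(2) subgroup.subset[OF subgroup] by (auto simp: orbit_ball_def)
  then show ?thesis
    using compact_Int_closed[OF compact_isometry_ball T(1)] by simp
qed

lemma compactin_orbit_ball: "compactin isometry_topology (orbit_ball r)"
proof -
  have "compactin (top_of_set (carrier isometry_group)) (orbit_ball r)"
    using compact_orbit_ball subgroup.subset[OF subgroup]
    by (auto simp: compactin_subtopology orbit_ball_def)
  then have "compactin isometry_topology (id ` orbit_ball r)"
    by (rule image_compactin[OF _ continuous_map_pointwise_isometry_topology])
  then show ?thesis by simp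
qed

lemma comp_orbit_ball:
  assumes "g \<in> orbit_ball r" and "h \<in> orbit_ball s"
  shows "g \<circ> h \<in> orbit_ball (r + s)"
  using assms comp_G[of g h] dist_G[of g "h base" base] dist_triangle[of "g (h base)" base "g base"]
  by (auto simp: orbit_ball_def)

lemma inverse_orbit_ball:
  assumes "g \<in> orbit_ball r"
  shows "\<exists>h\<in>orbit_ball r. h \<circ> g = id \<and> g \<circ> h = id"
proof -
  have g: "g \<in> G" "dist (g base) base \<le> r"
    using assms by (auto simp: orbit_ball_def)
  obtain h where h: "h \<in> G" "h \<circ> g = id" "g \<circ> h = id"
    using inverse_G[OF g(1)] by blast
  have "dist (h base) base = dist (g base) base"
    using dist_G[OF g(1), of "h base" base] pointfree_idE[OF h(3)] by (simp add: dist_commute)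
  then show ?thesis
    using h g by (intro bexI[where x = h]) (simp_all add: orbit_ball_def)
qed

lemma close_action:
  assumes "g \<in> orbit_ball r" and "close t u v"
  shows "close (t - r) (g \<circ> u) (g \<circ> v)"
proof -
  have g: "g \<in> G" "dist (g base) base \<le> r"
    using assms(1) by (auto simp: orbit_ball_def)
  have "close (t - dist (g base) base) (g \<circ> u) (g \<circ> v)"
    by (rule gromov_close_isometry[OF dist_G[OF g(1)] assms(2)])
  then show ?thesis
    by (rule gromov_close_mono) (use g(2) in simp)
qed

lemma asymptotic_action:
  "g \<in> G \<Longrightarrow> gromov_asymptotic u v \<Longrightarrow> gromov_asymptotic (g \<circ> u) (g \<circ> v)"
  using gromov_asymptotic_isometry[of g u v] dist_G[of g] by blast

lemma orbit_sequences_action: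
  assumes "g \<in> G" and "u \<in> orbit_sequences G base"
  shows "g \<circ> u \<in> orbit_sequences G base"
proof -
  have "range (g \<circ> u) \<subseteq> (\<lambda>g. g base) ` G"
  proof
    fix y assume "y \<in> range (g \<circ> u)"
    then obtain i where i: "y = g (u i)" by auto
    have "u i \<in> (\<lambda>g. g base) ` G"
      using assms(2) by (auto simp: orbit_sequences_def)
    then obtain h where "h \<in> G" "u i = h base" by auto
    then show "y \<in> (\<lambda>g. g base) ` G"
      using comp_G[OF assms(1)] i by (intro image_eqI[where x = "g \<circ> h"]) auto
  qed
  then show ?thesis
    using assms asymptotic_action[OF assms(1), of u u]
    by (simp add: orbit_sequences_def gromov_sequences_def)
qed

definition reaches :: "real \<Rightarrow> (nat \<Rightarrow> 'a) \<Rightarrow> (nat \<Rightarrow> 'a) \<Rightarrow> bool" where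
  "reaches r u v \<longleftrightarrow> (\<exists>h\<in>orbit_ball r. gromov_asymptotic (h \<circ> u) v)"

lemma reaches_mono: "reaches r u v \<Longrightarrow> r \<le> s \<Longrightarrow> reaches s u v"
  by (fastforce simp: reaches_def orbit_ball_def)

text \<open>Elements of the compact \<open>orbit_ball r\<close> that bring \<open>u\<close> closer
  and closer to \<open>v\<close> cluster at some \<open>l\<close>. If \<open>h i\<close> and
  \<open>l\<close> nearly agree at one far point \<open>p\<close> of \<open>u\<close>, then
  \<open>h i \<circ> u\<close> and \<open>l \<circ> u\<close> are close, since both stay close to
  the images of \<open>p\<close>.\<close>

lemma reaches_closed:
  assumes u: "u \<in> orbit_sequences G base" and "\<And>t. \<exists>w. close t v w \<and> reaches r u w"
  shows "reaches r u v"
proof -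
  have "\<exists>h\<in>orbit_ball r. close (real i) v (h \<circ> u)" for i
  proof -
    obtain w h where w: "close (real i + \<epsilon>) v w" and h: "h \<in> orbit_ball r" "gromov_asymptotic (h \<circ> u) w"
      using assms(2) unfolding reaches_def by blast
    have "gromov_asymptotic w (h \<circ> u)"
      using h(2) gromov_asymptotic_commute by blast
    then have "close (real i) v (h \<circ> u)"
      using close_asymptotic_right[OF w] by simp
    then show ?thesis
      using h(1) by blast
  qed
  then obtain h where h: "\<And>i. h i \<in> orbit_ball r" "\<And>i. close (real i) v (h i \<circ> u)"
    by metis
  obtain l where l: "l \<in> orbit_ball r"
    and cluster: "\<And>V. open V \<Longrightarrow> l \<in> V \<Longrightarrow> \<exists>\<^sub>F i in sequentially. h i \<in> V"
    using compact_cluster_point[where h = h, OF compact_orbit_ball h(1)] by blast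
  have "close t (l \<circ> u) v" for t
  proof -
    \<comment> \<open>The summands pay for the action of \<open>h i\<close> and of \<open>l\<close>
      (\<open>r\<close>), for the distance between \<open>h i p\<close> and \<open>l p\<close> (1),
      and for the two uses of \<open>close_trans\<close> (2\<epsilon>).\<close>
    define T where "T = t + r + 2 * \<epsilon> + 1"
    have "gromov_asymptotic u u"
      using u by (simp add: orbit_sequences_def gromov_sequences_def)
    then obtain M where M: "\<And>i j. i \<ge> M \<Longrightarrow> j \<ge> M \<Longrightarrow> T \<le> gromov_product base (u i) (u j)"
      unfolding asymptotic_iff_close gromov_close_def by meson
    define p where "p = u M"
    have up: "close T u (\<lambda>_. p)"
      using M unfolding gromov_close_def p_def by blast
    have "open {f :: 'a \<Rightarrow> 'a. dist (f p) (l p) < 1}"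
      by (intro open_Collect_less continuous_on_dist continuous_on_const
          continuous_on_product_coordinates)
    then have "\<exists>\<^sub>F i in sequentially. h i \<in> {f. dist (f p) (l p) < 1}"
      by (rule cluster) simp
    then obtain i where i: "i \<ge> nat \<lceil>t + \<epsilon>\<rceil>" "dist (h i p) (l p) < 1"
      unfolding frequently_sequentially by blast
    have "close (T - r) (h i \<circ> u) (\<lambda>_. h i p)" "close (T - r) (l \<circ> u) (\<lambda>_. l p)"
      using close_action[OF h(1)[of i] up] close_action[OF l up] by (simp_all add: comp_def)
    then have "close (T - r - 1) (h i \<circ> u) (\<lambda>_. l p)" "close (T - r - 1) (\<lambda>_. l p) (l \<circ> u)"
      using close_const_ball[of "T - r" "h i \<circ> u" "h i p" "l p" 1] i(2)
        gromov_close_mono[of base "T - r" "l \<circ> u" "\<lambda>_. l p" "T - r - 1"]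
      by (simp_all add: gromov_close_commute)
    then have "close (t + \<epsilon>) (h i \<circ> u) (l \<circ> u)"
      by (rule close_trans) (simp_all add: T_def)
    moreover have "close (t + \<epsilon>) v (h i \<circ> u)"
      by (rule gromov_close_mono[OF h(2)[of i]]) (use i(1) in linarith)
    ultimately have "close t v (l \<circ> u)"
      using close_trans[of "t + \<epsilon>" v "h i \<circ> u" "t + \<epsilon>" "l \<circ> u" t] by simp
    then show ?thesis
      by (simp add: gromov_close_commute)
  qed
  then show ?thesis
    using l unfolding reaches_def asymptotic_iff_close by blast
qed

lemma reaches_action:
  assumes g: "g \<in> orbit_ball s" and "reaches r u (g \<circ> v)"
  shows "reaches (r + s) u v"
proof -
  obtain h where h: "h \<in> orbit_ball r" "gromov_asymptotic (h \<circ> u) (g \<circ> v)"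
    using assms(2) unfolding reaches_def by blast
  obtain g' where g': "g' \<in> orbit_ball s" "g' \<circ> g = id"
    using inverse_orbit_ball[OF g] by blast
  have "gromov_asymptotic (g' \<circ> (h \<circ> u)) (g' \<circ> (g \<circ> v))"
    using asymptotic_action[OF _ h(2)] g'(1) by (simp add: orbit_ball_def)
  then have "gromov_asymptotic ((g' \<circ> h) \<circ> u) v"
    using g'(2) by (simp add: comp_assoc[symmetric])
  moreover have "g' \<circ> h \<in> orbit_ball (r + s)"
    using comp_orbit_ball[OF g'(1) h(1)] by (simp add: add.commute)
  ultimately show ?thesis
    unfolding reaches_def by blast
qed

end

locale boundary_transitive = closed_isometry_group +
  assumes transitive: "u \<in> orbit_sequences G base \<Longrightarrow> v \<in> orbit_sequences G base \<Longrightarrow>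
      \<exists>g\<in>G. gromov_asymptotic (g \<circ> u) v"
begin

lemma reaches_some:
  assumes "u \<in> orbit_sequences G base" and "v \<in> orbit_sequences G base"
  shows "\<exists>r. reaches r u v"
  using transitive[OF assms] unfolding reaches_def orbit_ball_def by blast

text \<open>
  A Baire category argument: the closed sets of points reached from \<open>u\<close> with bound \<open>n\<close> exhaust the
  limit set, so one of them has an interior point.
\<close>

lemma reaches_neighbourhood:
  assumes u: "u \<in> orbit_sequences G base"
  shows "\<exists>n t. \<exists>v\<in>orbit_sequences G base.
    \<forall>w\<in>orbit_sequences G base. close t v w \<longrightarrow> reaches n u w"
proof (rule ccontr)
  assume contra: "\<not> ?thesis"
  define P where "P n a \<longleftrightarrow> fst a \<in> orbit_sequences G base"
    for n :: nat and a :: "(nat \<Rightarrow> 'a) \<times> real"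
  \<comment> \<open>A pair consists of the centre and the threshold of a ball at infinity. The ball
    \<open>b\<close> is nested in \<open>a\<close> with margin \<epsilon>, and even its enlargement
    by \<epsilon> avoids everything reached with bound \<open>n\<close>.\<close>
  define Q where "Q n a b \<longleftrightarrow> snd a + \<epsilon> \<le> snd b \<and> close (snd a + \<epsilon>) (fst a) (fst b) \<and>
      (\<forall>w. close (snd b - \<epsilon>) (fst b) w \<longrightarrow> \<not> reaches (real n) u w)"
    for n :: nat and a b :: "(nat \<Rightarrow> 'a) \<times> real"
  have "\<exists>b. P (Suc n) b \<and> Q n a b" if a: "P n a" for n a
  proof -
    obtain w where w: "w \<in> orbit_sequences G base" "close (snd a + \<epsilon>) (fst a) w" "\<not> reaches (real n) u w"
      using contra a unfolding P_def by blast
    obtain s where s: "\<And>w'. close s w w' \<Longrightarrow> \<not> reaches (real n) u w'"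
      using reaches_closed[OF u, of w "real n"] w(3) by blast
    \<comment> \<open>In the new threshold, \<open>s + \<epsilon>\<close> keeps the enlarged ball
      away from the reached points, and \<open>snd a + \<epsilon>\<close> makes the thresholds
      grow.\<close>
    have "\<not> reaches (real n) u w'" if "close (max (s + \<epsilon>) (snd a + \<epsilon>) - \<epsilon>) w w'" for w'
      by (rule s) (use that in \<open>auto elim: gromov_close_mono\<close>)
    then show ?thesis
      using w(1,2) by (intro exI[where x = "(w, max (s + \<epsilon>) (snd a + \<epsilon>))"]) (simp add: P_def Q_def)
  qed
  moreover have "\<exists>a. P 0 a"
    using u by (auto simp: P_def)
  ultimately obtain f where f: "\<And>n. P n (f n)" "\<And>n. Q n (f n) (f (Suc n))"
    using dependent_nat_choice[of P Q] by blast
  define V T where "V n = fst (f n)" and "T n = snd (f n)" for n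
  have V: "V n \<in> orbit_sequences G base" for n
    using f(1) by (simp add: P_def V_def)
  have VT: "T n + \<epsilon> \<le> T (Suc n)" "close (T n + \<epsilon>) (V n) (V (Suc n))"
      "\<And>w. close (T (Suc n) - \<epsilon>) (V (Suc n)) w \<Longrightarrow> \<not> reaches (real n) u w" for n
    using f(2)[of n] by (auto simp: Q_def V_def T_def)
  \<comment> \<open>The growth of the thresholds by \<epsilon> absorbs the loss in
    \<open>close_trans\<close>, so all later centres remain in the \<open>k\<close>-th ball however
    long the chain is.\<close>
  have chain: "close (T k) (V k) (V (Suc (k + d)))" for k d
  proof (induction d arbitrary: k)
    case 0
    show ?case
      using gromov_close_mono[OF VT(2)[of k]] eps_pos by simp
  next
    case (Suc d)
    have "close (T (Suc k)) (V (Suc k)) (V (Suc (Suc k + d)))"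
      by (rule Suc.IH)
    then show ?case
      using close_trans[OF VT(2)[of k], of "T (Suc k)" "V (Suc (Suc k + d))" "T k"] VT(1)[of k]
      by simp
  qed
  have "V i \<in> gromov_sequences" "range (V i) \<subseteq> (\<lambda>g. g base) ` G" for i
    using V by (auto simp: orbit_sequences_def)
  then obtain w where w: "w \<in> gromov_sequences" "range w \<subseteq> (\<lambda>g. g base) ` G"
    and cluster: "\<And>t. \<exists>\<^sub>F i in sequentially. close t (V i) w"
    using exists_cluster_sequence[of V] by blast
  have "\<not> reaches (real n) u w" for n
  proof -
    obtain i where i: "i \<ge> Suc (Suc n)" "close (T (Suc n)) (V i) w"
      using cluster[of "T (Suc n)"] unfolding frequently_sequentially by blast
    have "close (T (Suc n)) (V (Suc n)) (V i)"
      using chain[of "Suc n"] le_Suc_ex[OF i(1)] by auto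
    then have "close (T (Suc n) - \<epsilon>) (V (Suc n)) w"
      by (rule close_trans[OF _ i(2)]) simp_all
    then show ?thesis
      by (rule VT(3))
  qed
  moreover obtain r where "reaches r u w"
    using reaches_some[OF u, of w] w by (auto simp: orbit_sequences_def)
  moreover obtain n :: nat where "r \<le> real n"
    using real_arch_simple by blast
  ultimately show False
    using reaches_mono by blast
qed

text \<open>Limit points reached only with larger and larger bounds would cluster at some
  \<open>w\<close>. A single \<open>g\<close> carries \<open>w\<close> into the neighbourhood found
  by Baire's argument, and with it infinitely many of these points; undoing \<open>g\<close> raises
  the bound only by its displacement.\<close>

lemma reaches_uniformly:
  assumes u: "u \<in> orbit_sequences G base"
  shows "\<exists>R. \<forall>w\<in>orbit_sequences G base. reaches R u w"
proof (rule ccontr)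
  assume contra: "\<not> ?thesis"
  obtain n v t where v: "v \<in> orbit_sequences G base"
    and nbhd: "\<forall>w\<in>orbit_sequences G base. close t v w \<longrightarrow> reaches n u w"
    using reaches_neighbourhood[OF u] by blast
  have "\<exists>w\<in>orbit_sequences G base. \<not> reaches (real i) u w" for i :: nat
    using contra by blast
  then obtain W where W: "\<And>i :: nat. W i \<in> orbit_sequences G base" "\<And>i. \<not> reaches (real i) u (W i)"
    by metis
  have "W i \<in> gromov_sequences" "range (W i) \<subseteq> (\<lambda>g. g base) ` G" for i
    using W by (auto simp: orbit_sequences_def)
  then obtain w where w: "w \<in> gromov_sequences" "range w \<subseteq> (\<lambda>g. g base) ` G"
    and cluster: "\<And>t. \<exists>\<^sub>F i in sequentially. close t (W i) w"
    using exists_cluster_sequence[of W] by blast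
  then obtain g where g: "g \<in> G" "gromov_asymptotic (g \<circ> w) v"
    using transitive[of w v] v by (auto simp: orbit_sequences_def)
  define d where "d = dist (g base) base"
  have gd: "g \<in> orbit_ball d"
    using g by (simp add: orbit_ball_def d_def)
  \<comment> \<open>The index exceeds the bound \<open>n + d\<close> that will be contradicted. In
    the threshold, \<open>d\<close> pays for the action of \<open>g\<close> and \<epsilon> for
    replacing \<open>g \<circ> w\<close> by \<open>v\<close>.\<close>
  obtain i where i: "i \<ge> nat \<lceil>n + d\<rceil>" "close (t + \<epsilon> + d) (W i) w"
    using cluster[of "t + \<epsilon> + d"] unfolding frequently_sequentially by blast
  have "close (t + \<epsilon>) (g \<circ> W i) (g \<circ> w)"
    using close_action[OF gd i(2)] by simp
  then have "close t (g \<circ> W i) v"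
    using close_asymptotic_right[OF _ g(2)] by simp
  then have "reaches n u (g \<circ> W i)"
    using nbhd orbit_sequences_action[OF g(1) W(1)] by (simp add: gromov_close_commute)
  then have "reaches (n + d) u (W i)"
    by (rule reaches_action[OF gd])
  then have "reaches (real i) u (W i)"
    by (rule reaches_mono) (use i(1) in linarith)
  then show False
    using W(2) by blast
qed


section \<open>Limit points behind orbit points and boundedness of quasimorphisms\<close>

text \<open>Every orbit point lies near a ray from \<open>base\<close> to a limit point, namely that
  of \<open>g \<circ> u\<close> or of \<open>g \<circ> v\<close>. If both failed, then seen from
  \<open>g base\<close> both sequences would lie in the direction of \<open>base\<close>, hence
  close to each other. Applying the inverse of \<open>g\<close> would make \<open>u\<close> and
  \<open>v\<close> closer than they are.\<close>

lemma exists_orbit_sequence_behind: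
  assumes u: "u \<in> orbit_sequences G base" "v \<in> orbit_sequences G base"
    and "\<not> gromov_asymptotic u v"
  shows "\<exists>C. \<forall>g\<in>G. \<exists>w\<in>orbit_sequences G base. close (dist base (g base) - C) w (\<lambda>_. g base)"
proof -
  obtain C' where C': "\<not> close C' u v"
    using assms(3) by (auto simp: asymptotic_iff_close)
  \<comment> \<open>Nonnegativity ensures that below \<open>d - C - \<epsilon>\<close> is the
    smaller of the two products in the four-point inequality.\<close>
  define C where "C = max C' 0"
  have C: "\<not> close C u v"
    using C' gromov_close_mono[of base C u v C'] by (auto simp: C_def)
  have "\<exists>w\<in>orbit_sequences G base. close (dist base (g base) - (C + 2 * \<epsilon>)) w (\<lambda>_. g base)"
    if g: "g \<in> G" for g
  proof (rule ccontr)
    assume contra: "\<not> ?thesis"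
    define d where "d = dist base (g base)"
    have far: "\<exists>N. \<forall>k\<ge>N. C + \<epsilon> \<le> gromov_product (g base) base (g (a k))"
      if a: "a \<in> orbit_sequences G base" for a
    proof (rule ccontr)
      assume near: "\<not> ?thesis"
      have ga: "g \<circ> a \<in> orbit_sequences G base"
        by (rule orbit_sequences_action[OF g a])
      then have "gromov_asymptotic (g \<circ> a) (g \<circ> a)"
        by (simp add: orbit_sequences_def gromov_sequences_def)
      then obtain M where M: "\<And>i j. i \<ge> M \<Longrightarrow> j \<ge> M \<Longrightarrow> d \<le> gromov_product base (g (a i)) (g (a j))"
        unfolding asymptotic_iff_close gromov_close_def comp_def by meson
      obtain k where k: "k \<ge> M" "gromov_product (g base) base (g (a k)) < C + \<epsilon>"
        using near by (meson not_le)
      \<comment> \<open>The products of a point with \<open>base\<close> seen from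
        \<open>g base\<close>, and with \<open>g base\<close> seen from \<open>base\<close>, add up
        to \<open>d\<close>.\<close>
      have "d - C - \<epsilon> \<le> gromov_product base (g (a k)) (g base)"
        using k(2) by (simp add: gromov_product_def d_def dist_commute field_simps)
      then have "d - (C + 2 * \<epsilon>) \<le> gromov_product base (g (a i)) (g base)" if "i \<ge> M" for i
        using M[OF that k(1)] four_point[of base "g (a i)" "g (a k)" "g base"] eps_pos
        by (simp add: C_def min_def split: if_splits)
      then have "close (d - (C + 2 * \<epsilon>)) (g \<circ> a) (\<lambda>_. g base)"
        unfolding gromov_close_def comp_def by blast
      then show False
        using contra ga by (auto simp: d_def)
    qed
    obtain M where M: "\<forall>k\<ge>M. C + \<epsilon> \<le> gromov_product (g base) base (g (u k))"
      using far[OF u(1)] by blast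
    obtain N where N: "\<forall>k\<ge>N. C + \<epsilon> \<le> gromov_product (g base) base (g (v k))"
      using far[OF u(2)] by blast
    have "C \<le> gromov_product base (u i) (v j)" if "i \<ge> max M N" "j \<ge> max M N" for i j
    proof -
      have "C + \<epsilon> \<le> gromov_product (g base) (g (u i)) base"
        "C + \<epsilon> \<le> gromov_product (g base) base (g (v j))"
        using M N that by (auto simp: gromov_product_commute)
      then have "C \<le> gromov_product (g base) (g (u i)) (g (v j))"
        using four_point[of "g base" "g (u i)" base "g (v j)"] by linarith
      then show ?thesis
        by (simp add: gromov_product_def dist_G[OF g])
    qed
    then have "close C u v"
      unfolding gromov_close_def by blast
    then show False
      using C by simp
  qed
  then show ?thesis by blast
qed

text \<open>
  The elements \<open>g\<close> and \<open>g\<inverse>\<close> move the base point by the same distance, each towards some limit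
  point. A bounded element carrying one limit point to the other thus carries \<open>g base\<close> close to
  \<open>g\<inverse> base\<close>.
\<close>

lemma exists_bounded_sandwich:
  assumes u: "u \<in> orbit_sequences G base" "v \<in> orbit_sequences G base"
    and "\<not> gromov_asymptotic u v"
  shows "\<exists>R K. \<forall>g\<in>G. \<exists>h\<in>orbit_ball R. g \<circ> h \<circ> g \<in> orbit_ball K"
proof -
  obtain C where C: "\<forall>g\<in>G. \<exists>w\<in>orbit_sequences G base. close (dist base (g base) - C) w (\<lambda>_. g base)"
    using exists_orbit_sequence_behind[OF assms] by blast
  obtain R where R: "\<forall>w\<in>orbit_sequences G base. reaches R u w"
    using reaches_uniformly[OF u(1)] by blast
  have "\<exists>h\<in>orbit_ball (2 * R). g \<circ> h \<circ> g \<in> orbit_ball (2 * C + 6 * R + 4 * \<epsilon>)"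
    if g: "g \<in> G" for g
  proof -
    define d where "d = dist base (g base)"
    obtain g' where g': "g' \<in> G" "g' \<circ> g = id" "g \<circ> g' = id"
      using inverse_G[OF g] by blast
    have d': "dist base (g' base) = d"
      using dist_G[OF g, of base "g' base"] pointfree_idE[OF g'(3)] by (simp add: d_def dist_commute)
    obtain w where w: "w \<in> orbit_sequences G base" "close (d - C) w (\<lambda>_. g base)"
      using C g unfolding d_def by blast
    obtain w' where w': "w' \<in> orbit_sequences G base" "close (d - C) w' (\<lambda>_. g' base)"
      using C g'(1) unfolding d'[symmetric] by blast
    obtain a where a: "a \<in> orbit_ball R" "gromov_asymptotic (a \<circ> u) w"
      using R w(1) unfolding reaches_def by blast
    obtain b where b: "b \<in> orbit_ball R" "gromov_asymptotic (b \<circ> u) w'"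
      using R w'(1) unfolding reaches_def by blast
    obtain a' where a': "a' \<in> orbit_ball R" "a' \<circ> a = id"
      using inverse_orbit_ball[OF a(1)] by blast
    \<comment> \<open>Uniform transitivity starts at \<open>u\<close>, so the limit point of
      \<open>w\<close> is first taken back to that of \<open>u\<close> and then on to that of
      \<open>w'\<close>.\<close>
    define h where "h = b \<circ> a'"
    have h: "h \<in> orbit_ball (2 * R)"
      using comp_orbit_ball[OF b(1) a'(1)] by (simp add: h_def)
    then have hG: "h \<in> G" "dist (h base) base \<le> 2 * R"
      by (auto simp: orbit_ball_def)
    have "h \<circ> (a \<circ> u) = b \<circ> (a' \<circ> a) \<circ> u"
      by (simp add: h_def comp_assoc)
    then have "gromov_asymptotic (b \<circ> u) (h \<circ> w)"
      using asymptotic_action[OF hG(1) a(2)] a'(2) by simp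
    then have hw: "gromov_asymptotic (h \<circ> w) w'"
      using b(2) asymptotic_trans gromov_asymptotic_commute by blast
    have "close (d - C - 2 * R) (\<lambda>_. h (g base)) (h \<circ> w)"
      using close_action[OF h w(2)] by (simp add: comp_def gromov_close_commute)
    then have hgw': "close (d - C - 2 * R - \<epsilon>) (\<lambda>_. h (g base)) w'"
      by (rule close_asymptotic_right[OF _ hw]) simp
    have "dist (a base) base \<le> R"
      using a(1) by (simp add: orbit_ball_def)
    then have "0 \<le> R"
      by (rule order_trans[OF zero_le_dist])
    then have "close (d - C - 2 * R - 2 * \<epsilon>) (\<lambda>_. h (g base)) (\<lambda>_. g' base)"
      using eps_pos by (intro close_trans[OF hgw' w'(2)]) auto
    then have "d - C - 2 * R - 2 * \<epsilon> \<le> gromov_product base (h (g base)) (g' base)"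
      by (auto simp: gromov_close_def)
    moreover have "dist base (h (g base)) \<le> d + 2 * R"
      using dist_triangle[of base "h (g base)" "h base"] hG(2) dist_G[OF hG(1), of base "g base"]
      by (simp add: d_def dist_commute)
    \<comment> \<open>The distances \<open>d + 2 * R\<close> and \<open>d\<close> from
      \<open>base\<close> are offset by twice the Gromov product, so \<open>d\<close>
      cancels.\<close>
    ultimately have "dist (h (g base)) (g' base) \<le> 2 * C + 6 * R + 4 * \<epsilon>"
      by (simp add: gromov_product_def d' field_simps)
    moreover have "dist (g (h (g base))) base = dist (h (g base)) (g' base)"
      using dist_G[OF g, of "h (g base)" "g' base"] pointfree_idE[OF g'(3)] by simp
    ultimately show ?thesis
      using h hG(1) g comp_G by (intro bexI[where x = h]) (auto simp: orbit_ball_def)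
  qed
  then show ?thesis by blast
qed

text \<open>Continuity bounds \<open>q\<close> on each compact \<open>orbit_ball\<close>. Expanding
  \<open>q (g \<circ> h \<circ> g)\<close> with error \<open>2 * D\<close> then bounds
  \<open>2 * q g\<close> by the values of \<open>q\<close> at two elements of fixed orbit
  balls.\<close>

lemma quasimorphism_bounded:
  fixes q :: "('a \<Rightarrow> 'a) \<Rightarrow> real"
  assumes u: "u \<in> orbit_sequences G base" "v \<in> orbit_sequences G base"
    and "\<not> gromov_asymptotic u v"
    and cont: "continuous_map (subtopology isometry_topology G) euclideanreal q"
    and D: "\<And>g h. g \<in> G \<Longrightarrow> h \<in> G \<Longrightarrow> \<bar>q (g \<circ> h) - q g - q h\<bar> \<le> D"
  shows "bounded (q ` G)"
proof -
  have "\<exists>M. \<forall>g\<in>orbit_ball r. \<bar>q g\<bar> \<le> M" for r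
  proof -
    have "compactin (subtopology isometry_topology G) (orbit_ball r)"
      using compactin_orbit_ball by (auto simp: compactin_subtopology orbit_ball_def)
    then have "compactin euclideanreal (q ` orbit_ball r)"
      using cont by (rule image_compactin)
    then have "bounded (q ` orbit_ball r)"
      by (simp add: compact_imp_bounded)
    then show ?thesis
      by (auto simp: bounded_iff)
  qed
  then obtain M where M: "\<And>r g. g \<in> orbit_ball r \<Longrightarrow> \<bar>q g\<bar> \<le> M r"
    by metis
  obtain R K where RK: "\<forall>g\<in>G. \<exists>h\<in>orbit_ball R. g \<circ> h \<circ> g \<in> orbit_ball K"
    using exists_bounded_sandwich[OF assms(1-3)] by blast
  have "\<bar>q g\<bar> \<le> M R + M K + 2 * D" if g: "g \<in> G" for g
  proof -
    obtain h where h: "h \<in> orbit_ball R" "g \<circ> h \<circ> g \<in> orbit_ball K"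
      using RK g by blast
    then have "h \<in> G"
      by (auto simp: orbit_ball_def)
    then have "\<bar>q (g \<circ> h) - q g - q h\<bar> \<le> D" "\<bar>q (g \<circ> h \<circ> g) - q (g \<circ> h) - q g\<bar> \<le> D"
      using D g comp_G by blast+
    then show ?thesis
      using M[OF h(1)] M[OF h(2)] by linarith
  qed
  then show ?thesis
    by (auto simp: bounded_iff)
qed

text \<open>By invariance \<phi> is determined by \<open>q g = \<phi> (pair id g)\<close>, and its
  coboundary at the triple of \<open>id\<close>, \<open>g\<close>, \<open>g \<circ> h\<close> is the
  defect \<open>q h - q (g \<circ> h) + q g\<close>. A bounded coboundary thus makes
  \<open>q\<close> a quasimorphism.\<close>

lemma bounded_cochain_if_bounded_coboundary:
  fixes \<phi> :: "(nat \<Rightarrow> 'a \<Rightarrow> 'a) \<Rightarrow> real" and \<G> :: "('a \<Rightarrow> 'a) monoid"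
  defines "\<G> \<equiv> isometry_group\<lparr>carrier := G\<rparr>"
  assumes u: "u \<in> orbit_sequences G base" "v \<in> orbit_sequences G base" "\<not> gromov_asymptotic u v"
    and \<phi>: "\<phi> \<in> continuous_cochains \<G> isometry_topology 1"
    and bdd: "bounded (coboundary_op \<G> 1 \<phi> ` tuples \<G> 2)"
  shows "\<phi> \<in> bounded_cochains \<G> isometry_topology 1"
proof -
  have \<G>: "carrier \<G> = G" "mult \<G> = (\<circ>)"
    by (simp_all add: \<G>_def isometry_group_def)
  have idG: "id \<in> G"
    using subgroup.one_closed[OF subgroup] by (simp add: isometry_group_def)
  define pair where "pair a b = (\<lambda>i\<in>{..1::nat}. if i = 0 then a else b)" for a b :: "'a \<Rightarrow> 'a"
  have pair_mem: "pair a b \<in> tuples \<G> 1" if "a \<in> G" "b \<in> G" for a b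
    using that by (auto simp: pair_def tuples_def \<G>)
  have pair_eq: "x = pair (x 0) (x 1)" if "x \<in> tuples \<G> 1" for x
    using that by (auto simp: pair_def tuples_def fun_eq_iff PiE_def extensional_def le_Suc_eq)
  have pair_inv: "\<phi> (pair (g \<circ> a) (g \<circ> b)) = \<phi> (pair a b)" if "g \<in> G" "a \<in> G" "b \<in> G" for g a b
  proof -
    have "(\<lambda>i\<in>{..1}. g \<otimes>\<^bsub>\<G>\<^esub> pair a b i) = pair (g \<circ> a) (g \<circ> b)"
      by (auto simp: pair_def \<G> fun_eq_iff)
    then show ?thesis
      using \<phi> that pair_mem[of a b] unfolding continuous_cochains_def \<G>(1) by force
  qed
  define q where "q g = \<phi> (pair id g)" for g
  have q: "\<phi> (pair a (a \<circ> b)) = q b" if "a \<in> G" "b \<in> G" for a b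
    using pair_inv[of a id b] idG that by (simp add: q_def)
  have "continuous_map (subtopology isometry_topology G)
      (product_topology (\<lambda>_. subtopology isometry_topology G) {..1}) (pair id)"
    unfolding continuous_map_componentwise
  proof (intro conjI ballI)
    fix k :: nat assume "k \<in> {..1}"
    then consider "k = 0" | "k = 1" by fastforce
    then show "continuous_map (subtopology isometry_topology G) (subtopology isometry_topology G)
        (\<lambda>g. pair id g k)"
      using idG closedin_subset[OF closed] by cases (auto simp: pair_def)
  qed (auto simp: pair_def)
  moreover have "continuous_map (product_topology (\<lambda>_. subtopology isometry_topology G) {..1})
      euclideanreal \<phi>"
    using \<phi> by (simp add: continuous_cochains_def \<G>)
  ultimately have cont: "continuous_map (subtopology isometry_topology G) euclideanreal q"
    unfolding q_def by (auto dest: continuous_map_compose simp: comp_def)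
  obtain D where D: "\<And>y. y \<in> tuples \<G> 2 \<Longrightarrow> \<bar>coboundary_op \<G> 1 \<phi> y\<bar> \<le> D"
    using bdd by (auto simp: bounded_iff)
  have quasi: "\<bar>q (g \<circ> h) - q g - q h\<bar> \<le> D" if gh: "g \<in> G" "h \<in> G" for g h
  proof -
    define y where "y = (\<lambda>i\<in>{..2::nat}. if i = 0 then id else if i = 1 then g else g \<circ> h)"
    have y: "y \<in> tuples \<G> 2"
      using gh idG comp_G by (auto simp: y_def tuples_def \<G>)
    have "omit 1 0 y = pair g (g \<circ> h)" "omit 1 1 y = pair id (g \<circ> h)" "omit 1 2 y = pair id g"
      by (auto simp: omit_def pair_def y_def fun_eq_iff)
    then have "coboundary_op \<G> 1 \<phi> y = q h - q (g \<circ> h) + q g"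
      using y q[OF gh] by (simp add: coboundary_op_def q_def numeral_2_eq_2)
    then show ?thesis
      using D[OF y] by linarith
  qed
  have "bounded (q ` G)"
    using quasimorphism_bounded[OF u cont quasi] .
  moreover have "\<phi> ` tuples \<G> 1 \<subseteq> q ` G"
  proof
    fix r assume "r \<in> \<phi> ` tuples \<G> 1"
    then obtain x where x: "x \<in> tuples \<G> 1" "r = \<phi> x" by auto
    have xG: "x 0 \<in> G" "x 1 \<in> G"
      using x(1) by (auto simp: tuples_def \<G>)
    obtain a where a: "a \<in> G" "a \<circ> x 0 = id" "x 0 \<circ> a = id"
      using inverse_G[OF xG(1)] by blast
    \<comment> \<open>Translating by the inverse \<open>a\<close> of \<open>x 0\<close> moves the
      pair to one starting at \<open>id\<close>.\<close>
    have "x 0 \<circ> (a \<circ> x 1) = x 1"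
      by (simp add: comp_assoc[symmetric] a(3))
    then have "\<phi> x = q (a \<circ> x 1)"
      using q[OF xG(1) comp_G[OF a(1) xG(2)]] pair_eq[OF x(1)] by simp
    then show "r \<in> q ` G"
      using x(2) comp_G[OF a(1) xG(2)] by blast
  qed
  ultimately show ?thesis
    using \<phi> bounded_subset unfolding bounded_cochains_def by blast
qed

end

section \<open>The kernel of the comparison map\<close>

lemma zero_continuous_cochain: "(\<lambda>_. 0) \<in> continuous_cochains G T n"
  by (simp add: continuous_cochains_def)

lemma diff_continuous_cochain:
  assumes "f \<in> continuous_cochains G T n" and "h \<in> continuous_cochains G T n"
  shows "(\<lambda>x. f x - h x) \<in> continuous_cochains G T n"
  using assms by (auto simp: continuous_cochains_def intro: continuous_map_diff)

lemma zero_bounded_cochain: "(\<lambda>_. 0) \<in> bounded_cochains G T n"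
  by (auto simp: bounded_cochains_def zero_continuous_cochain bounded_iff)

lemma diff_bounded_cochain:
  assumes "f \<in> bounded_cochains G T n" and "h \<in> bounded_cochains G T n"
  shows "(\<lambda>x. f x - h x) \<in> bounded_cochains G T n"
proof -
  have "bounded ((\<lambda>x. f x - h x) ` tuples G n)"
    using assms bounded_minus_comp[of f "tuples G n" h] by (simp add: bounded_cochains_def)
  then show ?thesis
    using assms diff_continuous_cochain by (auto simp: bounded_cochains_def)
qed

lemma coboundary_op_zero: "coboundary_op G n (\<lambda>_. 0) = (\<lambda>_. 0)"
  by (simp add: coboundary_op_def fun_eq_iff)

lemma coboundary_op_diff:
  "coboundary_op G n (\<lambda>x. f x - h x) = (\<lambda>x. coboundary_op G n f x - coboundary_op G n h x)"
  by (simp add: coboundary_op_def fun_eq_iff right_diff_distrib sum_subtractf)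

lemma coset_cocycle_group:
  assumes "(\<lambda>_. 0) \<in> B" and diff: "\<forall>a\<in>B. \<forall>b\<in>B. (\<lambda>x. a x - b x) \<in> B" and f: "f \<in> B"
  shows "B #>\<^bsub>cocycle_group G C n\<^esub> f = B"
proof (intro equalityI subsetI)
  fix a assume "a \<in> B #>\<^bsub>cocycle_group G C n\<^esub> f"
  then obtain b where b: "b \<in> B" "a = (\<lambda>x. b x + f x)"
    by (auto simp: r_coset_def cocycle_group_def)
  then show "a \<in> B"
    \<comment> \<open>Closure under differences also yields sums: \<open>b + f\<close> is
      \<open>b - (0 - f)\<close>.\<close>
    using bspec[OF bspec[OF diff b(1)] bspec[OF bspec[OF diff assms(1)] f]] by simp
next
  fix a assume "a \<in> B"
  then have "(\<lambda>x. a x - f x) \<in> B"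
    using diff f by blast
  moreover have "a = (\<lambda>x. (a x - f x) + f x)"
    by simp
  ultimately show "a \<in> B #>\<^bsub>cocycle_group G C n\<^esub> f"
    unfolding r_coset_def cocycle_group_def by fastforce
qed

lemma mem_coset_cocycle_group:
  assumes "(\<lambda>_. 0) \<in> B"
  shows "f \<in> B #>\<^bsub>cocycle_group G C n\<^esub> f"
  using assms by (auto simp: r_coset_def cocycle_group_def intro!: bexI)

text \<open>A bounded cocycle that vanishes in \<open>H_c\<close> has a continuous primitive. Under
  the assumption that very primitive is bounded, so the class already vanishes in
  \<open>H_cb\<close>.\<close>

lemma kernel_comparison_map_trivial:
  assumes bounded_primitive: "\<And>\<phi>. \<phi> \<in> continuous_cochains G T n \<Longrightarrow>
      coboundary_op G n \<phi> \<in> bounded_cochains G T (Suc n) \<Longrightarrow> \<phi> \<in> bounded_cochains G T n"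
  shows "kernel (H_cb G T (Suc n)) (H_c G T (Suc n)) (comparison_map G T (Suc n)) =
    {\<one>\<^bsub>H_cb G T (Suc n)\<^esub>}"
proof -
  define B where "B = coboundaries G (bounded_cochains G T) (Suc n)"
  define B' where "B' = coboundaries G (continuous_cochains G T) (Suc n)"
  have zero: "(\<lambda>_. 0) \<in> B" "(\<lambda>_. 0) \<in> B'"
    using imageI[OF zero_bounded_cochain, of "coboundary_op G n" G T n]
      imageI[OF zero_continuous_cochain, of "coboundary_op G n" G T n]
    unfolding B_def B'_def by (simp_all only: coboundaries.simps coboundary_op_zero)
  have diff: "\<forall>a\<in>B. \<forall>b\<in>B. (\<lambda>x. a x - b x) \<in> B"
  proof (intro ballI)
    fix a b assume mem: "a \<in> B" "b \<in> B"
    obtain \<phi> \<psi> where "\<phi> \<in> bounded_cochains G T n" "\<psi> \<in> bounded_cochains G T n"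
      and ab: "a = coboundary_op G n \<phi>" "b = coboundary_op G n \<psi>"
      using mem by (auto simp: B_def)
    then show "(\<lambda>x. a x - b x) \<in> B"
      using imageI[OF diff_bounded_cochain, of \<phi> G T n \<psi> "coboundary_op G n"]
      unfolding B_def ab coboundary_op_diff by simp
  qed
  have diff': "\<forall>a\<in>B'. \<forall>b\<in>B'. (\<lambda>x. a x - b x) \<in> B'"
  proof (intro ballI)
    fix a b assume mem: "a \<in> B'" "b \<in> B'"
    obtain \<phi> \<psi> where "\<phi> \<in> continuous_cochains G T n" "\<psi> \<in> continuous_cochains G T n"
      and ab: "a = coboundary_op G n \<phi>" "b = coboundary_op G n \<psi>"
      using mem by (auto simp: B'_def)
    then show "(\<lambda>x. a x - b x) \<in> B'"
      using imageI[OF diff_continuous_cochain, of \<phi> G T n \<psi> "coboundary_op G n"]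
      unfolding B'_def ab coboundary_op_diff by simp
  qed
  have sub: "B \<subseteq> B'"
    by (auto simp: B_def B'_def bounded_cochains_def)
  let ?Z = "cocycle_group G (bounded_cochains G T) (Suc n)"
  let ?Z' = "cocycle_group G (continuous_cochains G T) (Suc n)"
  have carrier: "carrier (H_cb G T (Suc n)) = (\<lambda>f. B #>\<^bsub>?Z\<^esub> f) ` cocycles G (bounded_cochains G T) (Suc n)"
    by (auto simp: cohomology_def FactGroup_def RCOSETS_def cocycle_group_def B_def)
  have one: "\<one>\<^bsub>H_cb G T (Suc n)\<^esub> = B" "\<one>\<^bsub>H_c G T (Suc n)\<^esub> = B'"
    by (simp_all add: cohomology_def FactGroup_def B_def B'_def)
  have comparison: "comparison_map G T (Suc n) U = (\<Union>f\<in>U. B' #>\<^bsub>?Z'\<^esub> f)" for U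
    by (simp add: comparison_map_def B'_def)
  have "X = B" if X: "X \<in> carrier (H_cb G T (Suc n))" "comparison_map G T (Suc n) X = B'" for X
  proof -
    obtain f where f: "f \<in> cocycles G (bounded_cochains G T) (Suc n)" "X = B #>\<^bsub>?Z\<^esub> f"
      using X(1) unfolding carrier by blast
    \<comment> \<open>So the coset of \<open>f\<close> is one of those united in the image of
      \<open>X\<close>, which forces \<open>f\<close> into \<open>B'\<close>.\<close>
    have "f \<in> X"
      unfolding f(2) by (rule mem_coset_cocycle_group[OF zero(1)])
    then have "f \<in> B'"
      using X(2) mem_coset_cocycle_group[OF zero(2)] unfolding comparison by blast
    then obtain \<phi> where \<phi>: "\<phi> \<in> continuous_cochains G T n" "f = coboundary_op G n \<phi>"
      by (auto simp: B'_def)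
    then have "f \<in> B"
      using bounded_primitive f(1) by (auto simp: B_def cocycles_def)
    then show ?thesis
      using coset_cocycle_group[OF zero(1) diff] f(2) by simp
  qed
  moreover have "B \<in> carrier (H_cb G T (Suc n))"
  proof -
    have "(\<lambda>_. 0) \<in> cocycles G (bounded_cochains G T) (Suc n)"
      by (simp add: cocycles_def zero_bounded_cochain coboundary_op_zero)
    then show ?thesis
      unfolding carrier using coset_cocycle_group[OF zero(1) diff zero(1)] by blast
  qed
  moreover have "comparison_map G T (Suc n) B = B'"
    unfolding comparison using coset_cocycle_group[OF zero(2) diff'] sub zero(1) by blast
  ultimately show ?thesis
    unfolding kernel_def one by blast
qed

theorem theoremB:
  fixes G :: "('a::metric_space \<Rightarrow> 'a) set" and x :: 'a
    and \<Lambda> :: "(nat \<Rightarrow> 'a) set set"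
    and \<G> :: "('a \<Rightarrow> 'a) monoid"
  defines "\<Lambda> \<equiv> limit_set G x"
    and "\<G> \<equiv> isometry_group\<lparr>carrier := G\<rparr>"
  assumes "proper_space TYPE('a)" and "geodesic_space TYPE('a)" and "hyperbolic_space TYPE('a)"
    and "subgroup G isometry_group" and "closedin isometry_topology G"
    and "\<not> elementary G x"
    and "\<forall>\<xi>\<in>\<Lambda>. \<forall>\<eta>\<in>\<Lambda>. \<forall>\<xi>'\<in>\<Lambda>. \<forall>\<eta>'\<in>\<Lambda>. \<xi> \<noteq> \<eta> \<and> \<xi>' \<noteq> \<eta>' \<longrightarrow>
           (\<exists>g\<in>G. boundary_action g \<xi> = \<xi>' \<and> boundary_action g \<eta> = \<eta>')"
  shows "kernel (H_cb \<G> isometry_topology 2) (H_c \<G> isometry_topology 2)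
           (comparison_map \<G> isometry_topology 2)
         = {\<one>\<^bsub>H_cb \<G> isometry_topology 2\<^esub>}"
proof -
  obtain \<epsilon> where \<epsilon>: "\<epsilon> > 0" "\<And>p x y z :: 'a.
      min (gromov_product p x y) (gromov_product p y z) - \<epsilon> \<le> gromov_product p x z"
    using hyperbolic_space_four_point[OF assms(4,5)] by blast
  interpret closed_isometry_group \<epsilon> x G
    by (intro closed_isometry_group.intro closed_isometry_group_axioms.intro
        proper_four_point_space.intro proper_four_point_space_axioms.intro four_point_space.intro)
      (fact \<epsilon> assms)+
  have limit_point: "\<exists>\<xi>\<in>\<Lambda>. u \<in> \<xi>" if "u \<in> orbit_sequences G x" for u
  proof -
    have u: "u \<in> gromov_sequences" "range u \<subseteq> (\<lambda>g. g x) ` G"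
      using that by (auto simp: orbit_sequences_def)
    obtain \<xi> where "\<xi> \<in> gromov_boundary" "u \<in> \<xi>"
      using boundary_point_of_sequence[OF u(1)] by blast
    then show ?thesis
      using limit_set_iff[of \<xi> G x] u(2) unfolding \<Lambda>_def by blast
  qed
  have boundary: "\<xi> \<in> gromov_boundary" if "\<xi> \<in> \<Lambda>" for \<xi>
    using that by (simp add: \<Lambda>_def limit_set_def)
  have sequence: "\<exists>u\<in>orbit_sequences G x. u \<in> \<xi>" if "\<xi> \<in> \<Lambda>" for \<xi>
    using limit_set_iff[OF boundary[OF that], of G x] that boundary_pointD(1)[OF boundary[OF that]]
    unfolding \<Lambda>_def orbit_sequences_def by blast
  have "\<not> \<Lambda> \<subseteq> {\<xi>}" for \<xi>
  proof
    assume "\<Lambda> \<subseteq> {\<xi>}"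
    then have "finite \<Lambda>" "card \<Lambda> \<le> 2"
      using finite_subset[of \<Lambda> "{\<xi>}"] card_mono[of "{\<xi>}" \<Lambda>] by auto
    then show False
      using assms(8) by (simp add: elementary_def \<Lambda>_def)
  qed
  \<comment> \<open>Every limit point completes to a pair off the diagonal, so transitivity on such
    pairs yields transitivity on points.\<close>
  then have other: "\<exists>\<eta>\<in>\<Lambda>. \<xi> \<noteq> \<eta>" for \<xi>
    by blast
  interpret boundary_transitive \<epsilon> x G
  proof unfold_locales
    fix u v assume u: "u \<in> orbit_sequences G x" and v: "v \<in> orbit_sequences G x"
    obtain \<xi> where \<xi>: "\<xi> \<in> \<Lambda>" "u \<in> \<xi>"
      using limit_point[OF u] by blast
    obtain \<xi>' where \<xi>': "\<xi>' \<in> \<Lambda>" "v \<in> \<xi>'"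
      using limit_point[OF v] by blast
    obtain \<eta> \<eta>' where "\<eta> \<in> \<Lambda>" "\<eta>' \<in> \<Lambda>" "\<xi> \<noteq> \<eta>" "\<xi>' \<noteq> \<eta>'"
      using other by meson
    then obtain g where g: "g \<in> G" "boundary_action g \<xi> = \<xi>'"
      using assms(9) \<xi>(1) \<xi>'(1) by meson
    then have "g \<circ> u \<in> \<xi>'"
      using \<xi>(2) by (auto simp: boundary_action_def)
    then have "gromov_asymptotic (g \<circ> u) v"
      using boundary_pointD(2)[OF boundary[OF \<xi>'(1)]] \<xi>'(2) by blast
    then show "\<exists>g\<in>G. gromov_asymptotic (g \<circ> u) v"
      using g(1) by blast
  qed
  obtain \<xi> \<eta> where \<xi>: "\<xi> \<in> \<Lambda>" and \<eta>: "\<eta> \<in> \<Lambda>" and "\<xi> \<noteq> \<eta>"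
    using other by meson
  obtain u v where u: "u \<in> orbit_sequences G x" "u \<in> \<xi>" and v: "v \<in> orbit_sequences G x" "v \<in> \<eta>"
    using sequence[OF \<xi>] sequence[OF \<eta>] by blast
  have "\<not> gromov_asymptotic u v"
  proof
    assume "gromov_asymptotic u v"
    then have "v \<in> \<xi>"
      using boundary_pointD(2)[OF boundary[OF \<xi>] u(2)] boundary_pointD(1)[OF boundary[OF \<eta>] v(2)]
      by blast
    then have "w \<in> \<xi> \<longleftrightarrow> w \<in> \<eta>" for w
      using boundary_pointD(2)[OF boundary[OF \<xi>], of v w] boundary_pointD(2)[OF boundary[OF \<eta>] v(2), of w]
      by blast
    then show False
      using \<open>\<xi> \<noteq> \<eta>\<close> by blast
  qed
  then show ?thesis
    using kernel_comparison_map_trivial[of \<G> isometry_topology 1]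
      bounded_cochain_if_bounded_coboundary[OF u(1) v(1)]
    unfolding \<G>_def numeral_2_eq_2 One_nat_def by (simp add: bounded_cochains_def)
qed

end
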